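(* Let $\mathbf{k}$ be a field. Skeletal Lie 2-algebras over $\mathbf{k}$ are classified up to equivalence by the following data: a Lie algebra $\mathfrak{g}$, a representation $M$ of $\mathfrak{g}$, and a class $[(s,j)]\in HL^3_{\mathrm{Lie}}(\mathfrak{g},M)$. Explicitly: every skeletal Lie 2-algebra $L$ with normalized complex $C$ (so $d=0$) determines the Lie algebra $\mathfrak{g}=C^0$, the representation $M=C^{-1}$ (via $x\cdot a=[x,a]=-[a,x]$) and the class of $(s,j)=(\langle\cdot,\cdot\rangle,\langle\cdot,\cdot,\cdot\rangle)$; every triple $(\mathfrak{g},M,[(s,j)])$ arises in this way; and two skeletal Lie 2-algebras are equivalent (in the 2-category of Lie 2-algebras) if and only if there are an isomorphism of their Lie algebras and a compatible isomorphism of their representations carrying one class to the other.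
   Context: **The space $HL^3_{\mathrm{Lie}}$.** For a Lie algebra $\mathfrak{g}$ and a representation $M$, write $[x,m]=x\cdot m$ and $[m,x]=-x\cdot m$. $ZL^3_{\mathrm{Lie}}(\mathfrak{g},M)$ is the space of pairs $(s,j)$ of linear maps $s:\mathfrak{g}^{\otimes2}\to M$, $j:\mathfrak{g}^{\otimes3}\to M$ such that for all $x,y,z,w\in\mathfrak{g}$ $[x,j(y,z,w)]-[y,j(x,z,w)]+[z,j(x,y,w)]+[j(x,y,z),w]-j([x,y],z,w)-j(y,[x,z],w)-j(y,z,[x,w])+j(x,[y,z],w)+j(x,z,[y,w])-j(x,y,[z,w])=0$; $j(x,y,z)+j(y,x,z)=[z,s(x,y)]$; $j(x,y,z)+j(x,z,y)=[x,s(y,z)]-s([x,y],z)-s(y,[x,z])$; $s([x,y],z)=s(z,[x,y])$. $BL^3_{\mathrm{Lie}}(\mathfrak{g},M)$ is the subspace of pairs $(s,j)$ for which there is a linear $f:\mathfrak{g}^{\otimes2}\to M$ with $s(x,y)=f(x,y)+f(y,x)$ and $j(x,y,z)=[x,f(y,z)]-[y,f(x,z)]-[f(x,y),z]-f([x,y],z)-f(y,[x,z])+f(x,[y,z])$. $HL^3_{\mathrm{Lie}}=ZL^3_{\mathrm{Lie}}/BL^3_{\mathrm{Lie}}$. **Linear categories.** A linear category $V$ is a category internal to $\mathbf{k}$-vector spaces: objects $V_0$ and arrows $V_1$ are vector spaces and source $s$, target $t$, identity $x\mapsto 1_x$ and composition are linear. Linear functors and natural transformations are those whose structure maps are linear.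 The tensor product is $(V\otimes W)_i=V_i\otimes W_i$. Objects appearing in arrow expressions denote their identity arrows. Its normalized complex is $C^0=V_0$, $C^{-1}=\ker s$, $d=t|_{\ker s}$. An arrow with source $x$ is written $(x,a)$ with $a\in\ker s$; its target is $x+da$, and composition is addition of the second components. $V$ is skeletal if isomorphic objects are equal, equivalently $d=0$. **Lie 2-algebras.** A Lie 2-algebra is a linear category $L$ with a bilinear functor $[\cdot,\cdot]:L\otimes L\to L$, a bilinear natural transformation $S_{x,y}:[x,y]\to-[y,x]$ and a trilinear natural transformation $J_{x,y,z}:[x,[y,z]]\to[[x,y],z]+[y,[x,z]]$, such that for all objects $x,y,z,w$, with $\hat J_{x,y,z}=J_{x,y,z}^{-1}-1_{[y,[x,z]]}$: (L1) $([J_{x,y,z},w]+1_{[[y,z],[x,w]]}+1_{[[x,z],[y,w]]}+[z,J_{x,y,w}])\circ(J_{x,[y,z],w}+J_{x,z,[y,w]})\circ[x,J_{y,z,w}]=(1_{[[[x,y],z],w]}+1_{[z,[[x,y],w]]}+J_{y,[x,z],w}+J_{y,z,[x,w]})\circ(J_{[x,y],z,w}+[y,J_{x,z,w}])\circ J_{x,y,[z,w]}$; (L2) $(-\hat J_{y,x,z})\circ[S_{x,y},z]=\hat J_{x,y,z}$; (L3) $(-J_{x,z,y})\circ[x,S_{y,z}]=(S_{[x,y],z}+S_{y,[x,z]})\circ J_{x,y,z}$; (L4) $(-S_{[y,z],x})\circ S_{x,[y,z]}=1_{[x,[y,z]]}$. The restrictions of the bracket give bilinear maps $C^0\times C^0\to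 C^0$, $C^0\times C^{-1}\to C^{-1}$, $C^{-1}\times C^0\to C^{-1}$, and $\langle\cdot,\cdot\rangle:C^0\otimes C^0\to C^{-1}$, $\langle\cdot,\cdot,\cdot\rangle:(C^0)^{\otimes3}\to C^{-1}$ are defined by $S_{x,y}=([x,y],-\langle x,y\rangle)$, $J_{x,y,z}=([x,[y,z]],-\langle x,y,z\rangle)$. A morphism $(F,F^2):L\to L'$ is a linear functor $F$ with a linear natural transformation $F^2_{x,y}:[F(x),F(y)]'\to F([x,y])$ such that $F(S_{x,y})\circ F^2_{x,y}=(-F^2_{y,x})\circ S'_{F(x),F(y)}$ and $F(J_{x,y,z})\circ F^2_{x,[y,z]}\circ[F(x),F^2_{y,z}]'=(F^2_{[x,y],z}+F^2_{y,[x,z]})\circ([F^2_{x,y},F(z)]'+[F(y),F^2_{x,z}]')\circ J'_{F(x),F(y),F(z)}$. The composite of $(F,F^2)$ and $(G,G^2)$ is $(GF,(GF)^2)$ with $(GF)^2_{x,y}=G(F^2_{x,y})\circ G^2_{F(x),F(y)}$. A 2-morphism $\Theta:(F,F^2)\Rightarrow(G,G^2)$ is a linear natural transformation $\Theta:F\Rightarrow G$ with $\Theta_{[x,y]}\circ F^2_{x,y}=G^2_{x,y}\circ[\Theta_x,\Theta_y]'$, composed as natural transformations. An equivalence is a morphism invertible up to invertible 2-morphisms.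
   Formalization: In characteristic 2, "Lie algebra" means antisymmetric bracket ([x,y]=-[y,x]) with Jacobi, not [x,x]=0, since a skeletal Lie 2-algebra gives only this; and "bilinear functor" means a functor in two variables (interchange law), which excludes a bracket on C^{-1} x C^{-1}. *)

theory Defs
  imports Complex_Main "HOL-Library.Product_Plus"
begin

section \<open>Vector spaces and multilinear maps\<close>

text \<open>
  A vector space is a subspace \<open>vcar V\<close> of an ambient vector space that occupies a whole type.
  Carriers are needed because the degree \<open>-1\<close> part \<open>ker s\<close> of the normalized complex is a
  proper subspace of the space of arrows.
\<close>

record ('k, 'v) vsp =
  smul :: "'k \<Rightarrow> 'v \<Rightarrow> 'v"
  vcar :: "'v set"

definition vspace :: "('k::field, 'v::ab_group_add, 'e) vsp_scheme \<Rightarrow> bool" where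
  "vspace V \<longleftrightarrow> vector_space (smul V) \<and> module.subspace (smul V) (vcar V)"

definition lin_map ::
  "('k, 'v::ab_group_add, 'e) vsp_scheme \<Rightarrow> ('k, 'w::ab_group_add, 'f) vsp_scheme \<Rightarrow> ('v \<Rightarrow> 'w) \<Rightarrow> bool"
where
  "lin_map V W f \<longleftrightarrow>
     (\<forall>x\<in>vcar V. f x \<in> vcar W) \<and>
     (\<forall>x\<in>vcar V. \<forall>y\<in>vcar V. f (x + y) = f x + f y) \<and>
     (\<forall>c. \<forall>x\<in>vcar V. f (smul V c x) = smul W c (f x))"

definition bilin_map ::
  "('k, 'u::ab_group_add, 'd) vsp_scheme \<Rightarrow> ('k, 'v::ab_group_add, 'e) vsp_scheme \<Rightarrow>
   ('k, 'w::ab_group_add, 'f) vsp_scheme \<Rightarrow> ('u \<Rightarrow> 'v \<Rightarrow> 'w) \<Rightarrow> bool"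
where
  "bilin_map U V W b \<longleftrightarrow>
     (\<forall>x\<in>vcar U. lin_map V W (\<lambda>y. b x y)) \<and>
     (\<forall>y\<in>vcar V. lin_map U W (\<lambda>x. b x y))"

definition trilin_map ::
  "('k, 't::ab_group_add, 'c) vsp_scheme \<Rightarrow> ('k, 'u::ab_group_add, 'd) vsp_scheme \<Rightarrow>
   ('k, 'v::ab_group_add, 'e) vsp_scheme \<Rightarrow> ('k, 'w::ab_group_add, 'f) vsp_scheme \<Rightarrow>
   ('t \<Rightarrow> 'u \<Rightarrow> 'v \<Rightarrow> 'w) \<Rightarrow> bool"
where
  "trilin_map T U V W h \<longleftrightarrow>
     (\<forall>x\<in>vcar T. bilin_map U V W (\<lambda>y z. h x y z)) \<and>
     (\<forall>y\<in>vcar U. \<forall>z\<in>vcar V. lin_map T W (\<lambda>x. h x y z))"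


section \<open>Lie algebras, representations and \<open>HL\<^sup>3\<close>\<close>

record ('k, 'g) lie_alg = "('k, 'g) vsp" +
  lbr :: "'g \<Rightarrow> 'g \<Rightarrow> 'g"

text \<open>
  Over an arbitrary field a Lie bracket is understood to be antisymmetric, \<open>[x,y] = -[y,x]\<close>.
  Outside characteristic 2 this is the same as \<open>[x,x] = 0\<close> (see below).  In characteristic 2
  it is weaker, and it is all that the transformation \<open>[x,y] \<rightarrow> -[y,x]\<close> of a skeletal
  Lie 2-algebra provides.
\<close>

definition lie_algebra :: "('k::field, 'g::ab_group_add, 'e) lie_alg_scheme \<Rightarrow> bool" where
  "lie_algebra G \<longleftrightarrow>
     vspace G \<and> bilin_map G G G (lbr G) \<and>
     (\<forall>x\<in>vcar G. \<forall>y\<in>vcar G. lbr G x y = - lbr G y x) \<and>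
     (\<forall>x\<in>vcar G. \<forall>y\<in>vcar G. \<forall>z\<in>vcar G.
        lbr G x (lbr G y z) + lbr G y (lbr G z x) + lbr G z (lbr G x y) = 0)"

lemma antisymmetric_iff_alternating:
  fixes G :: "('k::field, 'g::ab_group_add, 'e) lie_alg_scheme"
  assumes "(2::'k) \<noteq> 0" and V: "vspace G" and B: "bilin_map G G G (lbr G)"
  shows "(\<forall>x\<in>vcar G. \<forall>y\<in>vcar G. lbr G x y = - lbr G y x) \<longleftrightarrow> (\<forall>x\<in>vcar G. lbr G x x = 0)"
proof -
  interpret vector_space "smul G" using V by (simp add: vspace_def)
  have sub: "subspace (vcar G)" using V by (simp add: vspace_def)
  show ?thesis
  proof (intro iffI ballI)
    fix x assume a: "\<forall>x\<in>vcar G. \<forall>y\<in>vcar G. lbr G x y = - lbr G y x" and x: "x \<in> vcar G"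
    have "lbr G x x = - lbr G x x" using a x by blast
    then have "lbr G x x + lbr G x x = 0" by (metis add.left_inverse)
    then have "smul G 2 (lbr G x x) = 0"
      by (metis one_add_one scale_left_distrib scale_one)
    then show "lbr G x x = 0" using assms(1) by simp
  next
    fix x y assume a: "\<forall>x\<in>vcar G. lbr G x x = 0" and x: "x \<in> vcar G" and y: "y \<in> vcar G"
    have xy: "x + y \<in> vcar G" using sub x y by (simp add: subspace_add)
    have "lbr G (x + y) (x + y) = lbr G x x + lbr G x y + (lbr G y x + lbr G y y)"
      using B x y xy unfolding bilin_map_def lin_map_def by metis
    then have "lbr G x y + lbr G y x = 0" using a x y xy by simp
    then show "lbr G x y = - lbr G y x" by (simp add: eq_neg_iff_add_eq_0)
  qed
qed

record ('k, 'g, 'm) lie_rep = "('k, 'm) vsp" +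
  act :: "'g \<Rightarrow> 'm \<Rightarrow> 'm"

definition representation ::
  "('k::field, 'g::ab_group_add, 'e) lie_alg_scheme \<Rightarrow> ('k, 'g, 'm::ab_group_add, 'f) lie_rep_scheme \<Rightarrow> bool"
where
  "representation G M \<longleftrightarrow>
     vspace M \<and> bilin_map G M M (act M) \<and>
     (\<forall>x\<in>vcar G. \<forall>y\<in>vcar G. \<forall>m\<in>vcar M.
        act M (lbr G x y) m = act M x (act M y m) - act M y (act M x m))"

text \<open>The right-hand bracket \<open>[m,x] = -x\<cdot>m\<close>.\<close>

definition ract :: "('k, 'g, 'm::ab_group_add, 'f) lie_rep_scheme \<Rightarrow> 'm \<Rightarrow> 'g \<Rightarrow> 'm" where
  "ract M m x = - act M x m"

text \<open>
  Linear maps \<open>g\<^sup>\<otimes>\<^sup>2 \<rightarrow> M\<close> and \<open>g\<^sup>\<otimes>\<^sup>3 \<rightarrow> M\<close>.  The value is fixed to be \<open>0\<close> off the carrier, so that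
  equality of HOL functions is equality of maps.
\<close>

definition Hom2 ::
  "('k, 'g::ab_group_add, 'e) vsp_scheme \<Rightarrow> ('k, 'm::ab_group_add, 'f) vsp_scheme \<Rightarrow> ('g \<Rightarrow> 'g \<Rightarrow> 'm) set"
where
  "Hom2 G M = {s. bilin_map G G M s \<and> (\<forall>x y. \<not> (x \<in> vcar G \<and> y \<in> vcar G) \<longrightarrow> s x y = 0)}"

definition Hom3 ::
  "('k, 'g::ab_group_add, 'e) vsp_scheme \<Rightarrow> ('k, 'm::ab_group_add, 'f) vsp_scheme \<Rightarrow>
   ('g \<Rightarrow> 'g \<Rightarrow> 'g \<Rightarrow> 'm) set"
where
  "Hom3 G M = {j. trilin_map G G G M j \<and>
     (\<forall>x y z. \<not> (x \<in> vcar G \<and> y \<in> vcar G \<and> z \<in> vcar G) \<longrightarrow> j x y z = 0)}"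

type_synonym ('g, 'm) cochain = "('g \<Rightarrow> 'g \<Rightarrow> 'm) \<times> ('g \<Rightarrow> 'g \<Rightarrow> 'g \<Rightarrow> 'm)"

definition ZL3 ::
  "('k, 'g::ab_group_add, 'e) lie_alg_scheme \<Rightarrow> ('k, 'g, 'm::ab_group_add, 'f) lie_rep_scheme \<Rightarrow>
   ('g, 'm) cochain set"
where
  "ZL3 G M = {(s, j). s \<in> Hom2 G M \<and> j \<in> Hom3 G M \<and>
     (\<forall>x\<in>vcar G. \<forall>y\<in>vcar G. \<forall>z\<in>vcar G. \<forall>w\<in>vcar G.
        act M x (j y z w) - act M y (j x z w) + act M z (j x y w) + ract M (j x y z) w
        - j (lbr G x y) z w - j y (lbr G x z) w - j y z (lbr G x w)
        + j x (lbr G y z) w + j x z (lbr G y w) - j x y (lbr G z w) = 0) \<and>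
     (\<forall>x\<in>vcar G. \<forall>y\<in>vcar G. \<forall>z\<in>vcar G.
        j x y z + j y x z = act M z (s x y) \<and>
        j x y z + j x z y = act M x (s y z) - s (lbr G x y) z - s y (lbr G x z) \<and>
        s (lbr G x y) z = s z (lbr G x y))}"

definition BL3 ::
  "('k, 'g::ab_group_add, 'e) lie_alg_scheme \<Rightarrow> ('k, 'g, 'm::ab_group_add, 'f) lie_rep_scheme \<Rightarrow>
   ('g, 'm) cochain set"
where
  "BL3 G M = {(s, j). s \<in> Hom2 G M \<and> j \<in> Hom3 G M \<and> (\<exists>f\<in>Hom2 G M.
     (\<forall>x\<in>vcar G. \<forall>y\<in>vcar G. s x y = f x y + f y x) \<and>
     (\<forall>x\<in>vcar G. \<forall>y\<in>vcar G. \<forall>z\<in>vcar G.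
        j x y z = act M x (f y z) - act M y (f x z) - ract M (f x y) z
                  - f (lbr G x y) z - f y (lbr G x z) + f x (lbr G y z)))}"

definition cohomologous ::
  "('k, 'g::ab_group_add, 'e) lie_alg_scheme \<Rightarrow> ('k, 'g, 'm::ab_group_add, 'f) lie_rep_scheme \<Rightarrow>
   (('g, 'm) cochain \<times> ('g, 'm) cochain) set"
where
  "cohomologous G M = {((s, j), (s', j')). (s, j) \<in> ZL3 G M \<and> (s', j') \<in> ZL3 G M \<and>
     ((\<lambda>x y. s x y - s' x y), (\<lambda>x y z. j x y z - j' x y z)) \<in> BL3 G M}"

definition HL3 ::
  "('k, 'g::ab_group_add, 'e) lie_alg_scheme \<Rightarrow> ('k, 'g, 'm::ab_group_add, 'f) lie_rep_scheme \<Rightarrow>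
   ('g, 'm) cochain set set"
where
  "HL3 G M = ZL3 G M // cohomologous G M"

definition HL3_class ::
  "('k, 'g::ab_group_add, 'e) lie_alg_scheme \<Rightarrow> ('k, 'g, 'm::ab_group_add, 'f) lie_rep_scheme \<Rightarrow>
   ('g, 'm) cochain \<Rightarrow> ('g, 'm) cochain set"
where
  "HL3_class G M p = cohomologous G M `` {p}"

type_synonym ('k, 'g, 'm) classifying_data =
  "('k, 'g) lie_alg \<times> ('k, 'g, 'm) lie_rep \<times> ('g, 'm) cochain set"

definition classifying_data :: "('k::field, 'g::ab_group_add, 'm::ab_group_add) classifying_data \<Rightarrow> bool"
where
  "classifying_data = (\<lambda>(G, M, c). lie_algebra G \<and> representation G M \<and> c \<in> HL3 G M)"

definition lie_iso ::
  "('k, 'g::ab_group_add, 'e) lie_alg_scheme \<Rightarrow> ('k, 'h::ab_group_add, 'f) lie_alg_scheme \<Rightarrow>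
   ('g \<Rightarrow> 'h) \<Rightarrow> bool"
where
  "lie_iso G H \<alpha> \<longleftrightarrow> lin_map G H \<alpha> \<and> bij_betw \<alpha> (vcar G) (vcar H) \<and>
     (\<forall>x\<in>vcar G. \<forall>y\<in>vcar G. \<alpha> (lbr G x y) = lbr H (\<alpha> x) (\<alpha> y))"

definition rep_iso ::
  "('k, 'g::ab_group_add, 'e) lie_alg_scheme \<Rightarrow> ('k, 'g, 'm::ab_group_add, 'd) lie_rep_scheme \<Rightarrow>
   ('k, 'h, 'n::ab_group_add, 'f) lie_rep_scheme \<Rightarrow> ('g \<Rightarrow> 'h) \<Rightarrow> ('m \<Rightarrow> 'n) \<Rightarrow> bool"
where
  "rep_iso G M N \<alpha> \<beta> \<longleftrightarrow> lin_map M N \<beta> \<and> bij_betw \<beta> (vcar M) (vcar N) \<and>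
     (\<forall>x\<in>vcar G. \<forall>m\<in>vcar M. \<beta> (act M x m) = act N (\<alpha> x) (\<beta> m))"

text \<open>
  Transport of structure \<open>(s, j) \<mapsto> (\<beta> \<circ> s \<circ> (\<alpha>\<^sup>-\<^sup>1)\<^sup>\<otimes>\<^sup>2, \<beta> \<circ> j \<circ> (\<alpha>\<^sup>-\<^sup>1)\<^sup>\<otimes>\<^sup>3)\<close>.  On cohomology
  it acts by taking the image of a coset.
\<close>

definition transport ::
  "('k, 'g, 'e) lie_alg_scheme \<Rightarrow> ('k, 'h, 'f) lie_alg_scheme \<Rightarrow> ('g \<Rightarrow> 'h) \<Rightarrow> ('m \<Rightarrow> 'n::zero) \<Rightarrow>
   ('g, 'm) cochain \<Rightarrow> ('h, 'n) cochain"
where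
  "transport G H \<alpha> \<beta> = (\<lambda>(s, j). let \<alpha>' = inv_into (vcar G) \<alpha> in
     ((\<lambda>x y. if x \<in> vcar H \<and> y \<in> vcar H then \<beta> (s (\<alpha>' x) (\<alpha>' y)) else 0),
      (\<lambda>x y z. if x \<in> vcar H \<and> y \<in> vcar H \<and> z \<in> vcar H
               then \<beta> (j (\<alpha>' x) (\<alpha>' y) (\<alpha>' z)) else 0)))"

definition data_isomorphic ::
  "('k::field, 'g::ab_group_add, 'm::ab_group_add) classifying_data \<Rightarrow>
   ('k, 'h::ab_group_add, 'n::ab_group_add) classifying_data \<Rightarrow> bool"
where
  "data_isomorphic = (\<lambda>(G, M, c) (H, N, d).
     \<exists>\<alpha> \<beta>. lie_iso G H \<alpha> \<and> rep_iso G M N \<alpha> \<beta> \<and> transport G H \<alpha> \<beta> ` c = d)"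


section \<open>Linear categories\<close>

text \<open>The composite \<open>g \<cdot> f\<close> is meaningful only if \<open>src g = tgt f\<close>.\<close>

record ('k, 'o, 'a) lincat =
  Ob :: "('k, 'o) vsp"
  Ar :: "('k, 'a) vsp"
  src :: "'a \<Rightarrow> 'o"
  tgt :: "'a \<Rightarrow> 'o"
  idt :: "'o \<Rightarrow> 'a" ("\<iota>\<index>")
  cmp :: "'a \<Rightarrow> 'a \<Rightarrow> 'a" (infixr "\<cdot>\<index>" 60)

definition composable :: "('k, 'o, 'a, 'e) lincat_scheme \<Rightarrow> 'a \<Rightarrow> 'a \<Rightarrow> bool" where
  "composable V g f \<longleftrightarrow> g \<in> vcar (Ar V) \<and> f \<in> vcar (Ar V) \<and> src V g = tgt V f"

locale linear_category =
  fixes V :: "('k::field, 'o::ab_group_add, 'a::ab_group_add, 'e) lincat_scheme" (structure)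
  assumes Ob_vspace: "vspace (Ob V)"
    and Ar_vspace: "vspace (Ar V)"
    and src_linear: "lin_map (Ar V) (Ob V) (src V)"
    and tgt_linear: "lin_map (Ar V) (Ob V) (tgt V)"
    and idt_linear: "lin_map (Ob V) (Ar V) \<iota>"
    and comp_closed: "composable V g f \<Longrightarrow> g \<cdot> f \<in> vcar (Ar V)"
    and comp_add: "\<lbrakk>composable V g f; composable V g' f'\<rbrakk> \<Longrightarrow> (g + g') \<cdot> (f + f') = (g \<cdot> f) + (g' \<cdot> f')"
    and comp_smul: "composable V g f \<Longrightarrow> smul (Ar V) c g \<cdot> smul (Ar V) c f = smul (Ar V) c (g \<cdot> f)"
    and src_idt: "x \<in> vcar (Ob V) \<Longrightarrow> src V (\<iota> x) = x"
    and tgt_idt: "x \<in> vcar (Ob V) \<Longrightarrow> tgt V (\<iota> x) = x"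
    and src_comp: "composable V g f \<Longrightarrow> src V (g \<cdot> f) = src V f"
    and tgt_comp: "composable V g f \<Longrightarrow> tgt V (g \<cdot> f) = tgt V g"
    and comp_idt: "f \<in> vcar (Ar V) \<Longrightarrow> f \<cdot> \<iota> (src V f) = f"
    and idt_comp: "f \<in> vcar (Ar V) \<Longrightarrow> \<iota> (tgt V f) \<cdot> f = f"
    and comp_assoc: "\<lbrakk>composable V h g; composable V g f\<rbrakk> \<Longrightarrow> (h \<cdot> g) \<cdot> f = h \<cdot> (g \<cdot> f)"

definition inverse_arrows :: "('k, 'o, 'a, 'e) lincat_scheme \<Rightarrow> 'a \<Rightarrow> 'a \<Rightarrow> bool" where
  "inverse_arrows V f g \<longleftrightarrow> composable V g f \<and> composable V f g \<and>
     cmp V g f = idt V (src V f) \<and> cmp V f g = idt V (tgt V f)"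

definition inv_arrow :: "('k, 'o, 'a, 'e) lincat_scheme \<Rightarrow> 'a \<Rightarrow> 'a" where
  "inv_arrow V f = (THE g. inverse_arrows V f g)"

definition isomorphic_objects :: "('k, 'o, 'a, 'e) lincat_scheme \<Rightarrow> 'o \<Rightarrow> 'o \<Rightarrow> bool" where
  "isomorphic_objects V x y \<longleftrightarrow> (\<exists>f g. inverse_arrows V f g \<and> src V f = x \<and> tgt V f = y)"

definition skeletal :: "('k, 'o, 'a, 'e) lincat_scheme \<Rightarrow> bool" where
  "skeletal V \<longleftrightarrow> (\<forall>x\<in>vcar (Ob V). \<forall>y\<in>vcar (Ob V). isomorphic_objects V x y \<longrightarrow> x = y)"

definition ker_src :: "('k, 'o::zero, 'a, 'e) lincat_scheme \<Rightarrow> 'a set" where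
  "ker_src V = {a \<in> vcar (Ar V). src V a = 0}"

definition linear_functor ::
  "('k, 'o::ab_group_add, 'a::ab_group_add, 'e) lincat_scheme \<Rightarrow>
   ('k, 'p::ab_group_add, 'b::ab_group_add, 'f) lincat_scheme \<Rightarrow> ('o \<Rightarrow> 'p) \<Rightarrow> ('a \<Rightarrow> 'b) \<Rightarrow> bool"
where
  "linear_functor V W F0 F1 \<longleftrightarrow>
     lin_map (Ob V) (Ob W) F0 \<and> lin_map (Ar V) (Ar W) F1 \<and>
     (\<forall>f\<in>vcar (Ar V). src W (F1 f) = F0 (src V f) \<and> tgt W (F1 f) = F0 (tgt V f)) \<and>
     (\<forall>x\<in>vcar (Ob V). F1 (idt V x) = idt W (F0 x)) \<and>
     (\<forall>g f. composable V g f \<longrightarrow> F1 (cmp V g f) = cmp W (F1 g) (F1 f))"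

text \<open>
  A linear functor \<open>U \<otimes> V \<rightarrow> W\<close>, given by its values on pure tensors: a functor in two variables
  that is bilinear on objects and on arrows.  Composition in \<open>U \<otimes> V\<close> satisfies
  \<open>(g \<cdot> f) \<otimes> (g' \<cdot> f') = (g \<otimes> g') \<cdot> (f \<otimes> f')\<close>.
\<close>

definition bilinear_functor ::
  "('k, 'o::ab_group_add, 'a::ab_group_add, 'e) lincat_scheme \<Rightarrow>
   ('k, 'p::ab_group_add, 'b::ab_group_add, 'f) lincat_scheme \<Rightarrow>
   ('k, 'q::ab_group_add, 'c::ab_group_add, 'h) lincat_scheme \<Rightarrow>
   ('o \<Rightarrow> 'p \<Rightarrow> 'q) \<Rightarrow> ('a \<Rightarrow> 'b \<Rightarrow> 'c) \<Rightarrow> bool"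
where
  "bilinear_functor U V W B0 B1 \<longleftrightarrow>
     bilin_map (Ob U) (Ob V) (Ob W) B0 \<and> bilin_map (Ar U) (Ar V) (Ar W) B1 \<and>
     (\<forall>f\<in>vcar (Ar U). \<forall>f'\<in>vcar (Ar V).
        src W (B1 f f') = B0 (src U f) (src V f') \<and> tgt W (B1 f f') = B0 (tgt U f) (tgt V f')) \<and>
     (\<forall>x\<in>vcar (Ob U). \<forall>y\<in>vcar (Ob V). B1 (idt U x) (idt V y) = idt W (B0 x y)) \<and>
     (\<forall>g f g' f'. composable U g f \<and> composable V g' f' \<longrightarrow>
        B1 (cmp U g f) (cmp V g' f') = cmp W (B1 g g') (B1 f f'))"

text \<open>
  Transformations between (multi)linear functors \<open>F\<close> and \<open>G\<close> from \<open>V\<close>, \<open>V \<otimes> V\<close> or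
  \<open>V \<otimes> V \<otimes> V\<close> to \<open>W\<close>.  They are linear in the object arguments and natural in the arrow arguments.
\<close>

definition linear_nat_trans ::
  "('k, 'o::ab_group_add, 'a::ab_group_add, 'e) lincat_scheme \<Rightarrow>
   ('k, 'p::ab_group_add, 'b::ab_group_add, 'f) lincat_scheme \<Rightarrow>
   ('o \<Rightarrow> 'p) \<Rightarrow> ('a \<Rightarrow> 'b) \<Rightarrow> ('o \<Rightarrow> 'p) \<Rightarrow> ('a \<Rightarrow> 'b) \<Rightarrow> ('o \<Rightarrow> 'b) \<Rightarrow> bool"
where
  "linear_nat_trans V W F0 F1 G0 G1 \<theta> \<longleftrightarrow>
     lin_map (Ob V) (Ar W) \<theta> \<and>
     (\<forall>x\<in>vcar (Ob V). src W (\<theta> x) = F0 x \<and> tgt W (\<theta> x) = G0 x) \<and>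
     (\<forall>f\<in>vcar (Ar V). cmp W (\<theta> (tgt V f)) (F1 f) = cmp W (G1 f) (\<theta> (src V f)))"

definition bilinear_nat_trans ::
  "('k, 'o::ab_group_add, 'a::ab_group_add, 'e) lincat_scheme \<Rightarrow>
   ('k, 'p::ab_group_add, 'b::ab_group_add, 'f) lincat_scheme \<Rightarrow>
   ('o \<Rightarrow> 'o \<Rightarrow> 'p) \<Rightarrow> ('a \<Rightarrow> 'a \<Rightarrow> 'b) \<Rightarrow> ('o \<Rightarrow> 'o \<Rightarrow> 'p) \<Rightarrow> ('a \<Rightarrow> 'a \<Rightarrow> 'b) \<Rightarrow>
   ('o \<Rightarrow> 'o \<Rightarrow> 'b) \<Rightarrow> bool"
where
  "bilinear_nat_trans V W F0 F1 G0 G1 \<theta> \<longleftrightarrow>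
     bilin_map (Ob V) (Ob V) (Ar W) \<theta> \<and>
     (\<forall>x\<in>vcar (Ob V). \<forall>y\<in>vcar (Ob V). src W (\<theta> x y) = F0 x y \<and> tgt W (\<theta> x y) = G0 x y) \<and>
     (\<forall>f\<in>vcar (Ar V). \<forall>g\<in>vcar (Ar V).
        cmp W (\<theta> (tgt V f) (tgt V g)) (F1 f g) = cmp W (G1 f g) (\<theta> (src V f) (src V g)))"

definition trilinear_nat_trans ::
  "('k, 'o::ab_group_add, 'a::ab_group_add, 'e) lincat_scheme \<Rightarrow>
   ('k, 'p::ab_group_add, 'b::ab_group_add, 'f) lincat_scheme \<Rightarrow>
   ('o \<Rightarrow> 'o \<Rightarrow> 'o \<Rightarrow> 'p) \<Rightarrow> ('a \<Rightarrow> 'a \<Rightarrow> 'a \<Rightarrow> 'b) \<Rightarrow>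
   ('o \<Rightarrow> 'o \<Rightarrow> 'o \<Rightarrow> 'p) \<Rightarrow> ('a \<Rightarrow> 'a \<Rightarrow> 'a \<Rightarrow> 'b) \<Rightarrow> ('o \<Rightarrow> 'o \<Rightarrow> 'o \<Rightarrow> 'b) \<Rightarrow> bool"
where
  "trilinear_nat_trans V W F0 F1 G0 G1 \<theta> \<longleftrightarrow>
     trilin_map (Ob V) (Ob V) (Ob V) (Ar W) \<theta> \<and>
     (\<forall>x\<in>vcar (Ob V). \<forall>y\<in>vcar (Ob V). \<forall>z\<in>vcar (Ob V).
        src W (\<theta> x y z) = F0 x y z \<and> tgt W (\<theta> x y z) = G0 x y z) \<and>
     (\<forall>f\<in>vcar (Ar V). \<forall>g\<in>vcar (Ar V). \<forall>h\<in>vcar (Ar V).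
        cmp W (\<theta> (tgt V f) (tgt V g) (tgt V h)) (F1 f g h) =
        cmp W (G1 f g h) (\<theta> (src V f) (src V g) (src V h)))"


section \<open>Lie 2-algebras\<close>

text \<open>
  The bracket functor is written \<open>\<^bold>[x, y\<^bold>]\<close> on objects and \<open>\<lbrakk>f, g\<rbrakk>\<close> on arrows.  An object inside an
  arrow expression is replaced by its identity arrow \<open>\<iota> x\<close>.
\<close>

record ('k, 'o, 'a) lie2 = "('k, 'o, 'a) lincat" +
  obr :: "'o \<Rightarrow> 'o \<Rightarrow> 'o" ("\<^bold>[_,/ _\<^bold>]\<index>")
  abr :: "'a \<Rightarrow> 'a \<Rightarrow> 'a" ("\<lbrakk>_,/ _\<rbrakk>\<index>")
  altr :: "'o \<Rightarrow> 'o \<Rightarrow> 'a" ("\<S>\<index>")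
  jacr :: "'o \<Rightarrow> 'o \<Rightarrow> 'o \<Rightarrow> 'a" ("\<J>\<index>")

definition Jhat :: "('k, 'o, 'a::ab_group_add, 'e) lie2_scheme \<Rightarrow> 'o \<Rightarrow> 'o \<Rightarrow> 'o \<Rightarrow> 'a" where
  "Jhat L x y z = inv_arrow L (jacr L x y z) - idt L (obr L y (obr L x z))"

locale lie_2_algebra = linear_category L
  for L :: "('k::field, 'o::ab_group_add, 'a::ab_group_add, 'e) lie2_scheme" (structure) +
  assumes bracket_functor: "bilinear_functor L L L (obr L) (abr L)"
    and S_nat_trans: "bilinear_nat_trans L L
      (\<lambda>x y. \<^bold>[x, y\<^bold>]) (\<lambda>f g. \<lbrakk>f, g\<rbrakk>)
      (\<lambda>x y. - \<^bold>[y, x\<^bold>]) (\<lambda>f g. - \<lbrakk>g, f\<rbrakk>) \<S>"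
    and J_nat_trans: "trilinear_nat_trans L L
      (\<lambda>x y z. \<^bold>[x, \<^bold>[y, z\<^bold>]\<^bold>]) (\<lambda>f g h. \<lbrakk>f, \<lbrakk>g, h\<rbrakk>\<rbrakk>)
      (\<lambda>x y z. \<^bold>[\<^bold>[x, y\<^bold>], z\<^bold>] + \<^bold>[y, \<^bold>[x, z\<^bold>]\<^bold>]) (\<lambda>f g h. \<lbrakk>\<lbrakk>f, g\<rbrakk>, h\<rbrakk> + \<lbrakk>g, \<lbrakk>f, h\<rbrakk>\<rbrakk>) \<J>"
    and L1: "\<lbrakk>x \<in> vcar (Ob L); y \<in> vcar (Ob L); z \<in> vcar (Ob L); w \<in> vcar (Ob L)\<rbrakk> \<Longrightarrow>
      (\<lbrakk>\<J> x y z, \<iota> w\<rbrakk> + \<iota> \<^bold>[\<^bold>[y, z\<^bold>], \<^bold>[x, w\<^bold>]\<^bold>] + \<iota> \<^bold>[\<^bold>[x, z\<^bold>], \<^bold>[y, w\<^bold>]\<^bold>] + \<lbrakk>\<iota> z, \<J> x y w\<rbrakk>)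
        \<cdot> (\<J> x \<^bold>[y, z\<^bold>] w + \<J> x z \<^bold>[y, w\<^bold>])
        \<cdot> \<lbrakk>\<iota> x, \<J> y z w\<rbrakk>
      = (\<iota> \<^bold>[\<^bold>[\<^bold>[x, y\<^bold>], z\<^bold>], w\<^bold>] + \<iota> \<^bold>[z, \<^bold>[\<^bold>[x, y\<^bold>], w\<^bold>]\<^bold>] + \<J> y \<^bold>[x, z\<^bold>] w + \<J> y z \<^bold>[x, w\<^bold>])
        \<cdot> (\<J> \<^bold>[x, y\<^bold>] z w + \<lbrakk>\<iota> y, \<J> x z w\<rbrakk>)
        \<cdot> \<J> x y \<^bold>[z, w\<^bold>]"
    and L2: "\<lbrakk>x \<in> vcar (Ob L); y \<in> vcar (Ob L); z \<in> vcar (Ob L)\<rbrakk> \<Longrightarrow>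
      (- Jhat L y x z) \<cdot> \<lbrakk>\<S> x y, \<iota> z\<rbrakk> = Jhat L x y z"
    and L3: "\<lbrakk>x \<in> vcar (Ob L); y \<in> vcar (Ob L); z \<in> vcar (Ob L)\<rbrakk> \<Longrightarrow>
      (- \<J> x z y) \<cdot> \<lbrakk>\<iota> x, \<S> y z\<rbrakk> = (\<S> \<^bold>[x, y\<^bold>] z + \<S> y \<^bold>[x, z\<^bold>]) \<cdot> \<J> x y z"
    and L4: "\<lbrakk>x \<in> vcar (Ob L); y \<in> vcar (Ob L); z \<in> vcar (Ob L)\<rbrakk> \<Longrightarrow>
      (- \<S> \<^bold>[y, z\<^bold>] x) \<cdot> \<S> x \<^bold>[y, z\<^bold>] = \<iota> \<^bold>[x, \<^bold>[y, z\<^bold>]\<^bold>]"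

text \<open>
  An arrow \<open>f\<close> with source \<open>x\<close> is the pair \<open>(x, f - \<iota> x)\<close>, so that
  \<open>\<S> x y = (\<^bold>[x, y\<^bold>], -\<langle>x,y\<rangle>)\<close> and \<open>\<J> x y z = (\<^bold>[x, \<^bold>[y, z\<^bold>]\<^bold>], -\<langle>x,y,z\<rangle>)\<close> give the following pair.
\<close>

definition cochain_of :: "('k, 'o, 'a::ab_group_add, 'e) lie2_scheme \<Rightarrow> ('o, 'a) cochain" where
  "cochain_of L =
     ((\<lambda>x y. if x \<in> vcar (Ob L) \<and> y \<in> vcar (Ob L)
             then idt L (obr L x y) - altr L x y else 0),
      (\<lambda>x y z. if x \<in> vcar (Ob L) \<and> y \<in> vcar (Ob L) \<and> z \<in> vcar (Ob L)
               then idt L (obr L x (obr L y z)) - jacr L x y z else 0))"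

definition lie_alg_of :: "('k, 'o, 'a, 'e) lie2_scheme \<Rightarrow> ('k, 'o) lie_alg" where
  "lie_alg_of L = \<lparr>smul = smul (Ob L), vcar = vcar (Ob L), lbr = obr L\<rparr>"

definition rep_of :: "('k, 'o::zero, 'a, 'e) lie2_scheme \<Rightarrow> ('k, 'o, 'a) lie_rep" where
  "rep_of L = \<lparr>smul = smul (Ar L), vcar = ker_src L, act = (\<lambda>x a. abr L (idt L x) a)\<rparr>"

definition data_of ::
  "('k, 'o::ab_group_add, 'a::ab_group_add, 'e) lie2_scheme \<Rightarrow> ('k, 'o, 'a) classifying_data"
where
  "data_of L = (lie_alg_of L, rep_of L, HL3_class (lie_alg_of L) (rep_of L) (cochain_of L))"


section \<open>The 2-category of Lie 2-algebras\<close>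

record ('o, 'a, 'p, 'b) lie2_mor =
  F0 :: "'o \<Rightarrow> 'p"
  F1 :: "'a \<Rightarrow> 'b"
  F2 :: "'o \<Rightarrow> 'o \<Rightarrow> 'b"

definition lie2_morphism ::
  "('k::field, 'o::ab_group_add, 'a::ab_group_add, 'e) lie2_scheme \<Rightarrow>
   ('k, 'p::ab_group_add, 'b::ab_group_add, 'f) lie2_scheme \<Rightarrow> ('o, 'a, 'p, 'b) lie2_mor \<Rightarrow> bool"
where
  "lie2_morphism L L' F \<longleftrightarrow>
     linear_functor L L' (F0 F) (F1 F) \<and>
     bilinear_nat_trans L L'
       (\<lambda>x y. obr L' (F0 F x) (F0 F y)) (\<lambda>f g. abr L' (F1 F f) (F1 F g))
       (\<lambda>x y. F0 F (obr L x y)) (\<lambda>f g. F1 F (abr L f g)) (F2 F) \<and>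
     (\<forall>x\<in>vcar (Ob L). \<forall>y\<in>vcar (Ob L).
        F1 F (altr L x y) \<cdot>\<^bsub>L'\<^esub> F2 F x y = (- F2 F y x) \<cdot>\<^bsub>L'\<^esub> altr L' (F0 F x) (F0 F y)) \<and>
     (\<forall>x\<in>vcar (Ob L). \<forall>y\<in>vcar (Ob L). \<forall>z\<in>vcar (Ob L).
        F1 F (jacr L x y z) \<cdot>\<^bsub>L'\<^esub> F2 F x (obr L y z) \<cdot>\<^bsub>L'\<^esub> abr L' (idt L' (F0 F x)) (F2 F y z)
        = (F2 F (obr L x y) z + F2 F y (obr L x z))
          \<cdot>\<^bsub>L'\<^esub> (abr L' (F2 F x y) (idt L' (F0 F z)) + abr L' (idt L' (F0 F y)) (F2 F x z))
          \<cdot>\<^bsub>L'\<^esub> jacr L' (F0 F x) (F0 F y) (F0 F z))"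

definition lie2_id :: "('k, 'o, 'a, 'e) lie2_scheme \<Rightarrow> ('o, 'a, 'o, 'a) lie2_mor" where
  "lie2_id L = \<lparr>F0 = (\<lambda>x. x), F1 = (\<lambda>f. f), F2 = (\<lambda>x y. idt L (obr L x y))\<rparr>"

text \<open>\<open>lie2_comp L'' G F\<close> is the composite of \<open>F : L \<rightarrow> L'\<close> followed by \<open>G : L' \<rightarrow> L''\<close>.\<close>

definition lie2_comp ::
  "('k, 'q, 'c, 'e) lie2_scheme \<Rightarrow> ('p, 'b, 'q, 'c) lie2_mor \<Rightarrow> ('o, 'a, 'p, 'b) lie2_mor \<Rightarrow>
   ('o, 'a, 'q, 'c) lie2_mor"
where
  "lie2_comp L'' G F =
     \<lparr>F0 = (\<lambda>x. F0 G (F0 F x)), F1 = (\<lambda>f. F1 G (F1 F f)),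
      F2 = (\<lambda>x y. F1 G (F2 F x y) \<cdot>\<^bsub>L''\<^esub> F2 G (F0 F x) (F0 F y))\<rparr>"

definition lie2_2morphism ::
  "('k::field, 'o::ab_group_add, 'a::ab_group_add, 'e) lie2_scheme \<Rightarrow>
   ('k, 'p::ab_group_add, 'b::ab_group_add, 'f) lie2_scheme \<Rightarrow>
   ('o, 'a, 'p, 'b) lie2_mor \<Rightarrow> ('o, 'a, 'p, 'b) lie2_mor \<Rightarrow> ('o \<Rightarrow> 'b) \<Rightarrow> bool"
where
  "lie2_2morphism L L' F G \<Theta> \<longleftrightarrow>
     linear_nat_trans L L' (F0 F) (F1 F) (F0 G) (F1 G) \<Theta> \<and>
     (\<forall>x\<in>vcar (Ob L). \<forall>y\<in>vcar (Ob L).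
        \<Theta> (obr L x y) \<cdot>\<^bsub>L'\<^esub> F2 F x y = F2 G x y \<cdot>\<^bsub>L'\<^esub> abr L' (\<Theta> x) (\<Theta> y))"

definition invertible_2morphism ::
  "('k::field, 'o::ab_group_add, 'a::ab_group_add, 'e) lie2_scheme \<Rightarrow>
   ('k, 'p::ab_group_add, 'b::ab_group_add, 'f) lie2_scheme \<Rightarrow>
   ('o, 'a, 'p, 'b) lie2_mor \<Rightarrow> ('o, 'a, 'p, 'b) lie2_mor \<Rightarrow> ('o \<Rightarrow> 'b) \<Rightarrow> bool"
where
  "invertible_2morphism L L' F G \<Theta> \<longleftrightarrow>
     lie2_2morphism L L' F G \<Theta> \<and>
     (\<exists>\<Psi>. lie2_2morphism L L' G F \<Psi> \<and>
        (\<forall>x\<in>vcar (Ob L). \<Psi> x \<cdot>\<^bsub>L'\<^esub> \<Theta> x = idt L' (F0 F x) \<and> \<Theta> x \<cdot>\<^bsub>L'\<^esub> \<Psi> x = idt L' (F0 G x)))"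

definition lie2_equivalence ::
  "('k::field, 'o::ab_group_add, 'a::ab_group_add, 'e) lie2_scheme \<Rightarrow>
   ('k, 'p::ab_group_add, 'b::ab_group_add, 'f) lie2_scheme \<Rightarrow> ('o, 'a, 'p, 'b) lie2_mor \<Rightarrow> bool"
where
  "lie2_equivalence L L' F \<longleftrightarrow>
     lie2_morphism L L' F \<and>
     (\<exists>G. lie2_morphism L' L G \<and>
        (\<exists>\<Theta>. invertible_2morphism L L (lie2_comp L G F) (lie2_id L) \<Theta>) \<and>
        (\<exists>\<Theta>. invertible_2morphism L' L' (lie2_comp L' F G) (lie2_id L') \<Theta>))"

definition lie2_equivalent ::
  "('k::field, 'o::ab_group_add, 'a::ab_group_add, 'e) lie2_scheme \<Rightarrow>
   ('k, 'p::ab_group_add, 'b::ab_group_add, 'f) lie2_scheme \<Rightarrow> bool"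
where
  "lie2_equivalent L L' \<longleftrightarrow> (\<exists>F. lie2_equivalence L L' F)"

end

theory Submission
  imports Defs
begin

text \<open>
  In a linear category \<open>g \<cdot> f = g + f - \<iota> (tgt f)\<close>.  If the category is skeletal, then \<open>src = tgt\<close>, an
  arrow \<open>f\<close> is determined by its source and by \<open>f - \<iota> (src f)\<close>, and composition adds the latter.
  Each axiom of a Lie 2-algebra thus splits into an identity between objects and one between
  elements of \<open>ker s\<close>: the naturality of \<open>\<S>\<close> and \<open>\<J>\<close> gives the Lie algebra and its representation,
  and (L1)--(L4) are the four cocycle conditions.  In the same way a morphism consists of
  a homomorphism \<open>\<alpha>\<close> of Lie algebras, a compatible map \<open>\<beta>\<close> of representations and a bilinear \<open>\<phi>\<close>, the
  \<open>ker s\<close> component of \<open>F\<^sup>2\<close>, whose two coherence conditions say that \<open>\<phi>\<close> is a primitive for the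
  difference of the two cocycles.  A natural transformation to the identity forces equality of
  functors in the skeletal case, so that equivalences are the morphisms with \<open>\<alpha>\<close> and \<open>\<beta>\<close> bijective.
\<close>

section \<open>Linear and multilinear maps\<close>

lemma vspace_module: "vspace V \<Longrightarrow> module (smul V)"
  by (simp add: vspace_def module_iff_vector_space)

lemma vspace_subspace: "vspace V \<Longrightarrow> module.subspace (smul V) (vcar V)"
  by (simp add: vspace_def)

lemma vspace_zero [simp]: "vspace V \<Longrightarrow> 0 \<in> vcar V"
  by (rule module.subspace_0[OF vspace_module vspace_subspace])

lemma vspace_add [simp]: "\<lbrakk>vspace V; x \<in> vcar V; y \<in> vcar V\<rbrakk> \<Longrightarrow> x + y \<in> vcar V"
  by (rule module.subspace_add[OF vspace_module vspace_subspace])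

lemma vspace_smul [simp]: "\<lbrakk>vspace V; x \<in> vcar V\<rbrakk> \<Longrightarrow> smul V c x \<in> vcar V"
  by (rule module.subspace_scale[OF vspace_module vspace_subspace])

lemma vspace_neg [simp]: "\<lbrakk>vspace V; x \<in> vcar V\<rbrakk> \<Longrightarrow> - x \<in> vcar V"
  by (rule module.subspace_neg[OF vspace_module vspace_subspace])

lemma vspace_diff [simp]: "\<lbrakk>vspace V; x \<in> vcar V; y \<in> vcar V\<rbrakk> \<Longrightarrow> x - y \<in> vcar V"
  by (rule module.subspace_diff[OF vspace_module vspace_subspace])

lemma vspace_smul_add: "vspace V \<Longrightarrow> smul V c (x + y) = smul V c x + smul V c y"
  and vspace_smul_neg: "vspace V \<Longrightarrow> smul V c (- x) = - smul V c x"
  and vspace_smul_diff: "vspace V \<Longrightarrow> smul V c (x - y) = smul V c x - smul V c y"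
  and vspace_smul_zero: "vspace V \<Longrightarrow> smul V c 0 = 0"
  by (auto dest!: vspace_module simp: module.scale_right_distrib module.scale_minus_right
      module.scale_right_diff_distrib module.scale_zero_right)

lemmas vspace_smul_simps = vspace_smul_add vspace_smul_neg vspace_smul_diff vspace_smul_zero

lemma lin_map_closed: "\<lbrakk>lin_map V W f; x \<in> vcar V\<rbrakk> \<Longrightarrow> f x \<in> vcar W"
  and lin_map_add: "\<lbrakk>lin_map V W f; x \<in> vcar V; y \<in> vcar V\<rbrakk> \<Longrightarrow> f (x + y) = f x + f y"
  and lin_map_smul: "\<lbrakk>lin_map V W f; x \<in> vcar V\<rbrakk> \<Longrightarrow> f (smul V c x) = smul W c (f x)"
  unfolding lin_map_def by auto

lemma lin_map_zero: "\<lbrakk>lin_map V W f; vspace V\<rbrakk> \<Longrightarrow> f 0 = 0"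
  using lin_map_add[of V W f 0 0] by simp

lemma lin_map_neg: "\<lbrakk>lin_map V W f; vspace V; x \<in> vcar V\<rbrakk> \<Longrightarrow> f (- x) = - f x"
  using lin_map_add[of V W f x "- x"] by (simp add: lin_map_zero eq_neg_iff_add_eq_0 add.commute)

lemma lin_map_diff:
  "\<lbrakk>lin_map V W f; vspace V; x \<in> vcar V; y \<in> vcar V\<rbrakk> \<Longrightarrow> f (x - y) = f x - f y"
  using lin_map_add[of V W f x "- y"] by (simp add: lin_map_neg)

lemmas lin_map_simps = lin_map_closed lin_map_add lin_map_smul lin_map_zero lin_map_neg lin_map_diff

text \<open>Every element of the target carrier has the form \<open>f x\<close>, so linearity of the
  inverse is checked on such elements, where it cancels \<open>f\<close>. The cancellation applies
  to sums and multiples because the carrier of \<open>V\<close> is closed under them.\<close>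

lemma lin_map_inv_into:
  assumes f: "lin_map V W f" "bij_betw f (vcar V) (vcar W)" and V: "vspace V"
  shows "lin_map W V (inv_into (vcar V) f)"
proof -
  let ?g = "inv_into (vcar V) f"
  have inj: "inj_on f (vcar V)" and im: "f ` vcar V = vcar W"
    using f(2) by (auto simp: bij_betw_def)
  have g: "?g (f x) = x" if "x \<in> vcar V" for x
    using that inj by simp
  have "?g (f x + f y) = x + y" if "x \<in> vcar V" "y \<in> vcar V" for x y
    using g[of "x + y"] that V by (simp add: lin_map_add[OF f(1)])
  moreover have "?g (smul W c (f x)) = smul V c x" if "x \<in> vcar V" for x c
    using g[of "smul V c x"] that V by (simp add: lin_map_smul[OF f(1)])
  ultimately show ?thesis
    unfolding lin_map_def im[symmetric] by (simp add: g)
qed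

lemma bilin_closed: "\<lbrakk>bilin_map U V W b; x \<in> vcar U; y \<in> vcar V\<rbrakk> \<Longrightarrow> b x y \<in> vcar W"
  and bilin_add_left: "\<lbrakk>bilin_map U V W b; x \<in> vcar U; x' \<in> vcar U; y \<in> vcar V\<rbrakk>
    \<Longrightarrow> b (x + x') y = b x y + b x' y"
  and bilin_add_right: "\<lbrakk>bilin_map U V W b; x \<in> vcar U; y \<in> vcar V; y' \<in> vcar V\<rbrakk>
    \<Longrightarrow> b x (y + y') = b x y + b x y'"
  and bilin_smul_left: "\<lbrakk>bilin_map U V W b; x \<in> vcar U; y \<in> vcar V\<rbrakk>
    \<Longrightarrow> b (smul U c x) y = smul W c (b x y)"
  and bilin_smul_right: "\<lbrakk>bilin_map U V W b; x \<in> vcar U; y \<in> vcar V\<rbrakk>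
    \<Longrightarrow> b x (smul V c y) = smul W c (b x y)"
  unfolding bilin_map_def lin_map_def by auto

lemma bilin_zero_left: "\<lbrakk>bilin_map U V W b; vspace U; y \<in> vcar V\<rbrakk> \<Longrightarrow> b 0 y = 0"
  and bilin_neg_left: "\<lbrakk>bilin_map U V W b; vspace U; x \<in> vcar U; y \<in> vcar V\<rbrakk> \<Longrightarrow> b (- x) y = - b x y"
  and bilin_diff_left: "\<lbrakk>bilin_map U V W b; vspace U; x \<in> vcar U; x' \<in> vcar U; y \<in> vcar V\<rbrakk>
    \<Longrightarrow> b (x - x') y = b x y - b x' y"
  using lin_map_zero[of U W "\<lambda>x. b x y"] lin_map_neg[of U W "\<lambda>x. b x y"]
    lin_map_diff[of U W "\<lambda>x. b x y"] unfolding bilin_map_def by auto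

lemma bilin_zero_right: "\<lbrakk>bilin_map U V W b; vspace V; x \<in> vcar U\<rbrakk> \<Longrightarrow> b x 0 = 0"
  and bilin_neg_right: "\<lbrakk>bilin_map U V W b; vspace V; x \<in> vcar U; y \<in> vcar V\<rbrakk> \<Longrightarrow> b x (- y) = - b x y"
  and bilin_diff_right: "\<lbrakk>bilin_map U V W b; vspace V; x \<in> vcar U; y \<in> vcar V; y' \<in> vcar V\<rbrakk>
    \<Longrightarrow> b x (y - y') = b x y - b x y'"
  using lin_map_zero[of V W "b x"] lin_map_neg[of V W "b x"] lin_map_diff[of V W "b x"]
  unfolding bilin_map_def by auto

lemmas bilin_simps = bilin_closed bilin_add_left bilin_add_right bilin_smul_left bilin_smul_right
  bilin_zero_left bilin_neg_left bilin_diff_left bilin_zero_right bilin_neg_right bilin_diff_right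

lemma trilin_closed:
  "\<lbrakk>trilin_map T U V W h; x \<in> vcar T; y \<in> vcar U; z \<in> vcar V\<rbrakk> \<Longrightarrow> h x y z \<in> vcar W"
  unfolding trilin_map_def lin_map_def by auto

section \<open>Pullback of cochains along a linear map\<close>

text \<open>Members of \<open>Hom2\<close> and \<open>Hom3\<close> must vanish off the carrier, so
  precomposition with \<open>\<gamma>\<close> is cut off there. The maps that are pulled back may
  have any values off their own carriers.\<close>

definition pull2 ::
  "('k, 'h, 'e) vsp_scheme \<Rightarrow> ('h \<Rightarrow> 'g) \<Rightarrow> ('g \<Rightarrow> 'g \<Rightarrow> 'm::zero) \<Rightarrow> 'h \<Rightarrow> 'h \<Rightarrow> 'm"
where
  "pull2 H \<gamma> f = (\<lambda>x y. if x \<in> vcar H \<and> y \<in> vcar H then f (\<gamma> x) (\<gamma> y) else 0)"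

definition pull3 ::
  "('k, 'h, 'e) vsp_scheme \<Rightarrow> ('h \<Rightarrow> 'g) \<Rightarrow> ('g \<Rightarrow> 'g \<Rightarrow> 'g \<Rightarrow> 'm::zero) \<Rightarrow> 'h \<Rightarrow> 'h \<Rightarrow> 'h \<Rightarrow> 'm"
where
  "pull3 H \<gamma> j = (\<lambda>x y z. if x \<in> vcar H \<and> y \<in> vcar H \<and> z \<in> vcar H then j (\<gamma> x) (\<gamma> y) (\<gamma> z) else 0)"

lemma pull2_in [simp]: "\<lbrakk>x \<in> vcar H; y \<in> vcar H\<rbrakk> \<Longrightarrow> pull2 H \<gamma> f x y = f (\<gamma> x) (\<gamma> y)"
  by (simp add: pull2_def)

lemma pull3_in [simp]:
  "\<lbrakk>x \<in> vcar H; y \<in> vcar H; z \<in> vcar H\<rbrakk> \<Longrightarrow> pull3 H \<gamma> j x y z = j (\<gamma> x) (\<gamma> y) (\<gamma> z)"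
  by (simp add: pull3_def)

lemma pull2_Hom2:
  assumes "bilin_map G G M f" "lin_map H G \<gamma>" "vspace H"
  shows "pull2 H \<gamma> f \<in> Hom2 H M"
  using assms unfolding Hom2_def bilin_map_def lin_map_def by (auto simp: pull2_def)

lemma pull3_Hom3:
  assumes "trilin_map G G G M j" "lin_map H G \<gamma>" "vspace H"
  shows "pull3 H \<gamma> j \<in> Hom3 H M"
  using assms unfolding Hom3_def trilin_map_def bilin_map_def lin_map_def by (auto simp: pull3_def)

lemma bilin_map_compose:
  assumes "bilin_map G G M f" "lin_map H G \<gamma>" "lin_map M N \<beta>"
  shows "bilin_map H H N (\<lambda>x y. \<beta> (f (\<gamma> x) (\<gamma> y)))"
  using assms unfolding bilin_map_def lin_map_def by auto

lemma trilin_map_compose: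
  assumes "trilin_map G G G M j" "lin_map H G \<gamma>" "lin_map M N \<beta>"
  shows "trilin_map H H H N (\<lambda>x y z. \<beta> (j (\<gamma> x) (\<gamma> y) (\<gamma> z)))"
  using assms unfolding trilin_map_def bilin_map_def lin_map_def by auto

lemma lin_map_id: "lin_map V V (\<lambda>x. x)"
  unfolding lin_map_def by simp

lemma bilin_map_add:
  assumes "bilin_map U V W f" "bilin_map U V W g" "vspace W"
  shows "bilin_map U V W (\<lambda>x y. f x y + g x y)"
  using assms unfolding bilin_map_def lin_map_def by (auto simp: vspace_smul_simps algebra_simps)

lemma bilin_map_neg:
  assumes "bilin_map U V W f" "vspace W"
  shows "bilin_map U V W (\<lambda>x y. - f x y)"
  using assms unfolding bilin_map_def lin_map_def by (auto simp: vspace_smul_simps algebra_simps)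

lemma bilin_map_diff:
  assumes "bilin_map U V W f" "bilin_map U V W g" "vspace W"
  shows "bilin_map U V W (\<lambda>x y. f x y - g x y)"
  using bilin_map_add[OF assms(1) bilin_map_neg[OF assms(2,3)] assms(3)] by simp

lemma bilin_map_zero:
  assumes "vspace W"
  shows "bilin_map U V W (\<lambda>x y. 0)"
  using assms unfolding bilin_map_def lin_map_def by (auto simp: vspace_smul_simps)

lemma trilin_map_diff:
  assumes "trilin_map T U V W f" "trilin_map T U V W g" "vspace W"
  shows "trilin_map T U V W (\<lambda>x y z. f x y z - g x y z)"
  using assms unfolding trilin_map_def bilin_map_def lin_map_def
  by (auto simp: vspace_smul_simps algebra_simps)


section \<open>Isomorphisms of the classifying data\<close>

lemma ZL3_Hom: "(s, j) \<in> ZL3 G M \<Longrightarrow> s \<in> Hom2 G M \<and> j \<in> Hom3 G M"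
  by (simp add: ZL3_def)

text \<open>Differences of cocycles are again multilinear and vanish off the carrier, so membership
  in \<open>BL3\<close> reduces to the existence of a primitive \<open>f\<close>. The term with
  \<open>ract\<close> becomes \<open>+ act M z (f x y)\<close>.\<close>

lemma cohomologous_iff:
  assumes "vspace M"
  shows "((s, j), (s', j')) \<in> cohomologous G M \<longleftrightarrow>
    (s, j) \<in> ZL3 G M \<and> (s', j') \<in> ZL3 G M \<and> (\<exists>f\<in>Hom2 G M.
      (\<forall>x\<in>vcar G. \<forall>y\<in>vcar G. s x y - s' x y = f x y + f y x) \<and>
      (\<forall>x\<in>vcar G. \<forall>y\<in>vcar G. \<forall>z\<in>vcar G.
        j x y z - j' x y z = act M x (f y z) - act M y (f x z) + act M z (f x y)
                  - f (lbr G x y) z - f y (lbr G x z) + f x (lbr G y z)))"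
proof -
  have "(\<lambda>x y. s x y - s' x y) \<in> Hom2 G M \<and> (\<lambda>x y z. j x y z - j' x y z) \<in> Hom3 G M"
    if "(s, j) \<in> ZL3 G M" "(s', j') \<in> ZL3 G M"
    using that[THEN ZL3_Hom] assms by (auto simp: Hom2_def Hom3_def bilin_map_diff trilin_map_diff)
  then show ?thesis
    by (auto simp: cohomologous_def BL3_def ract_def)
qed

text \<open>
  The primitive \<open>\<phi>\<close> lives on \<open>G\<close> with values in \<open>N\<close>, so that no inverse of \<open>\<alpha>\<close> is needed to compare
  \<open>\<beta> \<circ> p\<close> with \<open>q \<circ> \<alpha>\<close>.
\<close>

definition cocycle_iso ::
  "('k::field, 'g::ab_group_add, 'c) lie_alg_scheme \<Rightarrow> ('k, 'g, 'm::ab_group_add, 'd) lie_rep_scheme \<Rightarrow>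
   ('g, 'm) cochain \<Rightarrow>
   ('k, 'h::ab_group_add, 'e) lie_alg_scheme \<Rightarrow> ('k, 'h, 'n::ab_group_add, 'f) lie_rep_scheme \<Rightarrow>
   ('h, 'n) cochain \<Rightarrow> ('g \<Rightarrow> 'h) \<Rightarrow> ('m \<Rightarrow> 'n) \<Rightarrow> ('g \<Rightarrow> 'g \<Rightarrow> 'n) \<Rightarrow> bool"
where
  "cocycle_iso G M p H N q \<alpha> \<beta> \<phi> \<longleftrightarrow>
     lie_iso G H \<alpha> \<and> rep_iso G M N \<alpha> \<beta> \<and> bilin_map G G N \<phi> \<and>
     (\<forall>x\<in>vcar G. \<forall>y\<in>vcar G.
        \<beta> (fst p x y) - fst q (\<alpha> x) (\<alpha> y) = \<phi> x y + \<phi> y x) \<and>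
     (\<forall>x\<in>vcar G. \<forall>y\<in>vcar G. \<forall>z\<in>vcar G.
        \<beta> (snd p x y z) - snd q (\<alpha> x) (\<alpha> y) (\<alpha> z) =
          act N (\<alpha> x) (\<phi> y z) - act N (\<alpha> y) (\<phi> x z) + act N (\<alpha> z) (\<phi> x y)
          - \<phi> (lbr G x y) z - \<phi> y (lbr G x z) + \<phi> x (lbr G y z))"

lemma cocycle_isoD:
  assumes "cocycle_iso G M p H N q \<alpha> \<beta> \<phi>" "x \<in> vcar G" "y \<in> vcar G"
  shows "\<beta> (fst p x y) - fst q (\<alpha> x) (\<alpha> y) = \<phi> x y + \<phi> y x"
    and "z \<in> vcar G \<Longrightarrow> \<beta> (snd p x y z) - snd q (\<alpha> x) (\<alpha> y) (\<alpha> z) =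
          act N (\<alpha> x) (\<phi> y z) - act N (\<alpha> y) (\<phi> x z) + act N (\<alpha> z) (\<phi> x y)
          - \<phi> (lbr G x y) z - \<phi> y (lbr G x z) + \<phi> x (lbr G y z)"
  using assms unfolding cocycle_iso_def by blast+

locale lie_module =
  fixes G :: "('k::field, 'g::ab_group_add, 'c) lie_alg_scheme"
    and M :: "('k, 'g, 'm::ab_group_add, 'd) lie_rep_scheme"
  assumes lie_algebra: "lie_algebra G" and representation: "representation G M"
begin

lemma vspaces [simp]: "vspace G" "vspace M"
  using lie_algebra representation unfolding lie_algebra_def representation_def by blast+

lemma lbr_bilin: "bilin_map G G G (lbr G)"
  using lie_algebra unfolding lie_algebra_def by blast

lemma act_bilin: "bilin_map G M M (act M)"
  using representation unfolding representation_def by blast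

lemmas lbr_simps [simp] = bilin_simps[OF lbr_bilin]
lemmas act_simps [simp] = bilin_simps[OF act_bilin]

lemma cohomologous_refl:
  assumes "p \<in> ZL3 G M"
  shows "(p, p) \<in> cohomologous G M"
proof -
  have "(\<lambda>x y. 0) \<in> Hom2 G M" by (simp add: Hom2_def bilin_map_zero)
  then show ?thesis
    using assms by (cases p) (auto simp: cohomologous_iff intro!: bexI[of _ "\<lambda>x y. 0"])
qed

end

section \<open>Transport of cocycles and their classes along an isomorphism of Lie algebras and
  representations\<close>

locale data_iso = G: lie_module G M + H: lie_module H N
  for G :: "('k::field, 'g::ab_group_add, 'c) lie_alg_scheme"
    and M :: "('k, 'g, 'm::ab_group_add, 'd) lie_rep_scheme"
    and H :: "('k, 'h::ab_group_add, 'e) lie_alg_scheme"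
    and N :: "('k, 'h, 'n::ab_group_add, 'f) lie_rep_scheme" +
  fixes \<alpha> :: "'g \<Rightarrow> 'h" and \<beta> :: "'m \<Rightarrow> 'n"
  assumes lie_iso: "lie_iso G H \<alpha>" and rep_iso: "rep_iso G M N \<alpha> \<beta>"
begin

abbreviation "\<gamma> \<equiv> inv_into (vcar G) \<alpha>"
abbreviation "\<delta> \<equiv> inv_into (vcar M) \<beta>"

lemma lin: "lin_map G H \<alpha>" "lin_map M N \<beta>"
  and bij: "bij_betw \<alpha> (vcar G) (vcar H)" "bij_betw \<beta> (vcar M) (vcar N)"
  using lie_iso rep_iso by (auto simp: lie_iso_def rep_iso_def)

lemma lin': "lin_map H G \<gamma>" "lin_map N M \<delta>"
  using lin bij by (auto intro: lin_map_inv_into)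

lemma bij': "bij_betw \<gamma> (vcar H) (vcar G)" "bij_betw \<delta> (vcar N) (vcar M)"
  using bij by (auto intro: bij_betw_inv_into)

lemmas \<alpha>_simps [simp] = lin_map_simps[OF lin(1)]
lemmas \<beta>_simps [simp] = lin_map_simps[OF lin(2)]
lemmas \<gamma>_simps [simp] = lin_map_simps[OF lin'(1)]
lemmas \<delta>_simps [simp] = lin_map_simps[OF lin'(2)]

lemma inverse_simps [simp]:
  "x \<in> vcar G \<Longrightarrow> \<gamma> (\<alpha> x) = x" "y \<in> vcar H \<Longrightarrow> \<alpha> (\<gamma> y) = y"
  "m \<in> vcar M \<Longrightarrow> \<delta> (\<beta> m) = m" "n \<in> vcar N \<Longrightarrow> \<beta> (\<delta> n) = n"
  using bij by (auto simp: bij_betw_inv_into_left bij_betw_inv_into_right)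

lemma \<alpha>_lbr [simp]: "\<lbrakk>x \<in> vcar G; y \<in> vcar G\<rbrakk> \<Longrightarrow> \<alpha> (lbr G x y) = lbr H (\<alpha> x) (\<alpha> y)"
  using lie_iso by (simp add: lie_iso_def)

lemma \<beta>_act [simp]: "\<lbrakk>x \<in> vcar G; m \<in> vcar M\<rbrakk> \<Longrightarrow> \<beta> (act M x m) = act N (\<alpha> x) (\<beta> m)"
  using rep_iso by (simp add: rep_iso_def)

lemma \<gamma>_lbr [simp]: "\<lbrakk>x \<in> vcar H; y \<in> vcar H\<rbrakk> \<Longrightarrow> \<gamma> (lbr H x y) = lbr G (\<gamma> x) (\<gamma> y)"
  using inverse_simps(1)[of "lbr G (\<gamma> x) (\<gamma> y)"] by simp

lemma \<delta>_act [simp]: "\<lbrakk>x \<in> vcar H; n \<in> vcar N\<rbrakk> \<Longrightarrow> \<delta> (act N x n) = act M (\<gamma> x) (\<delta> n)"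
  using inverse_simps(3)[of "act M (\<gamma> x) (\<delta> n)"] by simp

text \<open>Makes the setting symmetric: every result about \<open>\<alpha>\<close> and
  \<open>\<beta>\<close> can be interpreted for \<open>\<gamma>\<close> and \<open>\<delta>\<close>,
  which supplies the reverse inclusions between classes.\<close>

lemma inverse: "data_iso H N G M \<gamma> \<delta>"
  by (unfold_locales; simp add: lie_iso_def rep_iso_def lin' bij')

lemma transport_eq:
  "transport G H \<alpha> \<beta> (s, j) =
    (pull2 H \<gamma> (\<lambda>x y. \<beta> (s x y)), pull3 H \<gamma> (\<lambda>x y z. \<beta> (j x y z)))"
  by (simp add: transport_def pull2_def pull3_def Let_def)

text \<open>The cocycle equations of the transported pair are the images under
  \<open>\<beta>\<close> of those of \<open>r\<close> at the preimages of the arguments, since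
  \<open>\<alpha>\<close> and \<open>\<beta>\<close> respect bracket and action.\<close>

lemma transport_ZL3:
  assumes "r \<in> ZL3 G M"
  shows "transport G H \<alpha> \<beta> r \<in> ZL3 H N"
proof -
  obtain s j where r: "r = (s, j)" by (cases r)
  have sj: "(s, j) \<in> ZL3 G M" using assms r by simp
  then have s: "bilin_map G G M s" and j: "trilin_map G G G M j"
    by (auto simp: ZL3_def Hom2_def Hom3_def)
  note [simp] = bilin_closed[OF s] trilin_closed[OF j]
  have "pull2 H \<gamma> (\<lambda>x y. \<beta> (s x y)) \<in> Hom2 H N" "pull3 H \<gamma> (\<lambda>x y z. \<beta> (j x y z)) \<in> Hom3 H N"
    using bilin_map_compose[OF s lin_map_id lin(2)] trilin_map_compose[OF j lin_map_id lin(2)] lin'(1)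
    by (auto intro: pull2_Hom2 pull3_Hom3)
  moreover
  { fix x y z w assume H: "x \<in> vcar H" "y \<in> vcar H" "z \<in> vcar H" "w \<in> vcar H"
    \<comment> \<open>With \<open>x\<close> written as \<open>\<alpha> x'\<close>, the rule
      \<open>\<beta>_act\<close> produces exactly the action of \<open>x\<close>. At the end the
      primed names are replaced by preimages under \<open>\<gamma>\<close>, as they occur in
      \<open>transport\<close>.\<close>
    define x' y' z' w' where d: "x' = \<gamma> x" "y' = \<gamma> y" "z' = \<gamma> z" "w' = \<gamma> w"
    have G: "x' \<in> vcar G" "y' \<in> vcar G" "z' \<in> vcar G" "w' \<in> vcar G" using H d by auto
    have E: "x = \<alpha> x'" "y = \<alpha> y'" "z = \<alpha> z'" "w = \<alpha> w'" using H d by auto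
    have "\<beta> (act M x' (j y' z' w') - act M y' (j x' z' w') + act M z' (j x' y' w')
       + ract M (j x' y' z') w'
       - j (lbr G x' y') z' w' - j y' (lbr G x' z') w' - j y' z' (lbr G x' w')
       + j x' (lbr G y' z') w' + j x' z' (lbr G y' w') - j x' y' (lbr G z' w')) = \<beta> 0"
      using sj G unfolding ZL3_def by simp
    moreover have "\<beta> (j x' y' z' + j y' x' z') = \<beta> (act M z' (s x' y'))"
      "\<beta> (j x' y' z' + j x' z' y') = \<beta> (act M x' (s y' z') - s (lbr G x' y') z' - s y' (lbr G x' z'))"
      "\<beta> (s (lbr G x' y') z') = \<beta> (s z' (lbr G x' y'))"
      using sj G unfolding ZL3_def by simp_all
    ultimately have
     "act N x (\<beta> (j y' z' w')) - act N y (\<beta> (j x' z' w')) + act N z (\<beta> (j x' y' w'))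
       + ract N (\<beta> (j x' y' z')) w
       - \<beta> (j (lbr G x' y') z' w') - \<beta> (j y' (lbr G x' z') w') - \<beta> (j y' z' (lbr G x' w'))
       + \<beta> (j x' (lbr G y' z') w') + \<beta> (j x' z' (lbr G y' w')) - \<beta> (j x' y' (lbr G z' w')) = 0 \<and>
      \<beta> (j x' y' z') + \<beta> (j y' x' z') = act N z (\<beta> (s x' y')) \<and>
      \<beta> (j x' y' z') + \<beta> (j x' z' y') =
        act N x (\<beta> (s y' z')) - \<beta> (s (lbr G x' y') z') - \<beta> (s y' (lbr G x' z')) \<and>
      \<beta> (s (lbr G x' y') z') = \<beta> (s z' (lbr G x' y'))"
      using G by (simp add: E ract_def)
    note this[unfolded d] }
  ultimately show ?thesis
    unfolding r transport_eq ZL3_def by simp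
qed

lemma transport_inverse:
  assumes "r \<in> ZL3 H N"
  shows "transport G H \<alpha> \<beta> (transport H G \<gamma> \<delta> r) = r"
proof -
  obtain s j where r: "r = (s, j)" by (cases r)
  interpret I: data_iso H N G M \<gamma> \<delta> by (rule inverse)
  have sj: "s \<in> Hom2 H N" "j \<in> Hom3 H N" using assms r by (auto simp: ZL3_def)
  then have "bilin_map H H N s" "trilin_map H H H N j" by (auto simp: Hom2_def Hom3_def)
  note [simp] = bilin_closed[OF this(1)] trilin_closed[OF this(2)]
  \<comment> \<open>The chosen inverse of \<open>\<gamma>\<close> agrees with
    \<open>\<alpha>\<close> on the carrier only. This suffices because \<open>s\<close> and
    \<open>j\<close> vanish off the carrier, as does every transported pair.\<close>
  have "I.\<gamma> x = \<alpha> x" if "x \<in> vcar G" for x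
    using that by (metis I.inverse_simps(2) I.\<gamma>_simps(1) inverse_simps(2))
  with sj show ?thesis
    unfolding r transport_eq I.transport_eq
    by (auto simp: pull2_def pull3_def fun_eq_iff Hom2_def Hom3_def)
qed

text \<open>Applying \<open>\<delta>\<close> to the equations at \<open>\<gamma> x\<close>,
  \<open>\<gamma> y\<close>, \<open>\<gamma> z\<close> brings them back to values in
  \<open>M\<close>. The primitive changes sign because the two cocycles exchange roles in the
  difference.\<close>

lemma cocycle_iso_inverse:
  assumes "cocycle_iso G M p H N q \<alpha> \<beta> \<phi>" "p \<in> ZL3 G M" "q \<in> ZL3 H N"
  shows "cocycle_iso H N q G M p \<gamma> \<delta> (\<lambda>x y. - \<delta> (\<phi> (\<gamma> x) (\<gamma> y)))"
proof -
  interpret I: data_iso H N G M \<gamma> \<delta> by (rule inverse)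
  have \<phi>: "bilin_map G G N \<phi>" using assms(1) by (simp add: cocycle_iso_def)
  have bi: "bilin_map G G M (fst p)" "bilin_map H H N (fst q)"
    and tri: "trilin_map G G G M (snd p)" "trilin_map H H H N (snd q)"
    using assms(2,3) by (auto simp: ZL3_def Hom2_def Hom3_def)
  note [simp] = bilin_closed[OF \<phi>] bi[THEN bilin_closed] tri[THEN trilin_closed]
  { fix x y z assume H: "x \<in> vcar H" "y \<in> vcar H" "z \<in> vcar H"
    have "\<beta> (fst p (\<gamma> x) (\<gamma> y)) - fst q x y = \<phi> (\<gamma> x) (\<gamma> y) + \<phi> (\<gamma> y) (\<gamma> x)"
      using H cocycle_isoD(1)[OF assms(1), of "\<gamma> x" "\<gamma> y"] by simp
    then have "\<delta> (\<beta> (fst p (\<gamma> x) (\<gamma> y)) - fst q x y) = \<delta> (\<phi> (\<gamma> x) (\<gamma> y) + \<phi> (\<gamma> y) (\<gamma> x))"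
      by simp
    then have "\<delta> (fst q x y) - fst p (\<gamma> x) (\<gamma> y) = - \<delta> (\<phi> (\<gamma> x) (\<gamma> y)) + - \<delta> (\<phi> (\<gamma> y) (\<gamma> x))"
      using H by (simp add: algebra_simps)
    moreover
    have "\<beta> (snd p (\<gamma> x) (\<gamma> y) (\<gamma> z)) - snd q x y z =
       act N x (\<phi> (\<gamma> y) (\<gamma> z)) - act N y (\<phi> (\<gamma> x) (\<gamma> z)) + act N z (\<phi> (\<gamma> x) (\<gamma> y))
       - \<phi> (lbr G (\<gamma> x) (\<gamma> y)) (\<gamma> z) - \<phi> (\<gamma> y) (lbr G (\<gamma> x) (\<gamma> z)) + \<phi> (\<gamma> x) (lbr G (\<gamma> y) (\<gamma> z))"
      using H cocycle_isoD(2)[OF assms(1), of "\<gamma> x" "\<gamma> y" "\<gamma> z"] by simp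
    then have "\<delta> (\<beta> (snd p (\<gamma> x) (\<gamma> y) (\<gamma> z)) - snd q x y z) = \<delta> (
       act N x (\<phi> (\<gamma> y) (\<gamma> z)) - act N y (\<phi> (\<gamma> x) (\<gamma> z)) + act N z (\<phi> (\<gamma> x) (\<gamma> y))
       - \<phi> (lbr G (\<gamma> x) (\<gamma> y)) (\<gamma> z) - \<phi> (\<gamma> y) (lbr G (\<gamma> x) (\<gamma> z)) + \<phi> (\<gamma> x) (lbr G (\<gamma> y) (\<gamma> z)))"
      by simp
    then have "\<delta> (snd q x y z) - snd p (\<gamma> x) (\<gamma> y) (\<gamma> z) =
       - act M (\<gamma> x) (\<delta> (\<phi> (\<gamma> y) (\<gamma> z))) + act M (\<gamma> y) (\<delta> (\<phi> (\<gamma> x) (\<gamma> z)))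
       - act M (\<gamma> z) (\<delta> (\<phi> (\<gamma> x) (\<gamma> y)))
       + \<delta> (\<phi> (lbr G (\<gamma> x) (\<gamma> y)) (\<gamma> z)) + \<delta> (\<phi> (\<gamma> y) (lbr G (\<gamma> x) (\<gamma> z)))
       - \<delta> (\<phi> (\<gamma> x) (lbr G (\<gamma> y) (\<gamma> z)))"
      using H by (simp add: algebra_simps)
    note calculation this }
  then show ?thesis
    using bilin_map_neg[OF bilin_map_compose[OF \<phi> lin'] G.vspaces(2)]
    by (simp add: cocycle_iso_def I.lie_iso I.rep_iso)
qed

lemma transport_class_subset:
  assumes iso: "cocycle_iso G M p H N q \<alpha> \<beta> \<phi>" and p: "p \<in> ZL3 G M" and q: "q \<in> ZL3 H N"
  shows "transport G H \<alpha> \<beta> ` HL3_class G M p \<subseteq> HL3_class H N q"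
proof
  fix t assume "t \<in> transport G H \<alpha> \<beta> ` HL3_class G M p"
  then obtain r where r: "(p, r) \<in> cohomologous G M" and t: "t = transport G H \<alpha> \<beta> r"
    by (auto simp: HL3_class_def)
  obtain s j s' j' u k where pq: "p = (s, j)" "q = (s', j')" "r = (u, k)"
    by (cases p, cases q, cases r)
  have rZ: "(u, k) \<in> ZL3 G M" using r pq by (simp add: cohomologous_iff)
  obtain f where f: "f \<in> Hom2 G M"
    and f1: "\<And>x y. \<lbrakk>x \<in> vcar G; y \<in> vcar G\<rbrakk> \<Longrightarrow> s x y - u x y = f x y + f y x"
    and f2: "\<And>x y z. \<lbrakk>x \<in> vcar G; y \<in> vcar G; z \<in> vcar G\<rbrakk> \<Longrightarrow>
      j x y z - k x y z = act M x (f y z) - act M y (f x z) + act M z (f x y)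
                  - f (lbr G x y) z - f y (lbr G x z) + f x (lbr G y z)"
    using r unfolding pq by (auto simp: cohomologous_iff)
  have fb: "bilin_map G G M f" using f by (simp add: Hom2_def)
  have \<phi>: "bilin_map G G N \<phi>" using iso by (simp add: cocycle_iso_def)
  have bi: "bilin_map G G M s" "bilin_map G G M u"
    and tri: "trilin_map G G G M j" "trilin_map G G G M k"
    using p rZ pq by (auto simp: ZL3_def Hom2_def Hom3_def)
  note [simp] = bilin_closed[OF \<phi>] bilin_closed[OF fb] bi[THEN bilin_closed] tri[THEN trilin_closed]
  \<comment> \<open>On preimages, \<open>q - \<beta> r = \<beta> (p - r) - (\<beta> p - q)\<close>.
    The first bracket has the primitive \<open>f\<close> and the second difference has
    \<open>\<phi>\<close>, whence the primitive \<open>\<beta> f - \<phi>\<close>.\<close>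
  define f' where "f' = pull2 H \<gamma> (\<lambda>x y. \<beta> (f x y) - \<phi> x y)"
  have "f' \<in> Hom2 H N"
    unfolding f'_def
    by (rule pull2_Hom2[where G = G])
      (use bilin_map_diff[OF bilin_map_compose[OF fb lin_map_id lin(2)] \<phi>] lin' in auto)
  moreover
  { fix x y z assume H: "x \<in> vcar H" "y \<in> vcar H" "z \<in> vcar H"
    have "s' x y - \<beta> (u (\<gamma> x) (\<gamma> y)) =
        \<beta> (s (\<gamma> x) (\<gamma> y) - u (\<gamma> x) (\<gamma> y)) - (\<beta> (s (\<gamma> x) (\<gamma> y)) - s' x y)"
      using H by simp
    also have "\<dots> = f' x y + f' y x"
      unfolding f1[OF \<gamma>_simps(1)[OF H(1)] \<gamma>_simps(1)[OF H(2)]]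
      using H cocycle_isoD(1)[OF iso, of "\<gamma> x" "\<gamma> y"] by (simp add: pq f'_def)
    finally have s_eq: "s' x y - \<beta> (u (\<gamma> x) (\<gamma> y)) = f' x y + f' y x" .
    have "j' x y z - \<beta> (k (\<gamma> x) (\<gamma> y) (\<gamma> z)) =
        \<beta> (j (\<gamma> x) (\<gamma> y) (\<gamma> z) - k (\<gamma> x) (\<gamma> y) (\<gamma> z)) - (\<beta> (j (\<gamma> x) (\<gamma> y) (\<gamma> z)) - j' x y z)"
      using H by simp
    also have "\<dots> = act N x (f' y z) - act N y (f' x z) + act N z (f' x y)
       - f' (lbr H x y) z - f' y (lbr H x z) + f' x (lbr H y z)"
      unfolding f2[OF \<gamma>_simps(1)[OF H(1)] \<gamma>_simps(1)[OF H(2)] \<gamma>_simps(1)[OF H(3)]]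
      using H cocycle_isoD(2)[OF iso, of "\<gamma> x" "\<gamma> y" "\<gamma> z"] by (simp add: pq f'_def)
    finally have "j' x y z - \<beta> (k (\<gamma> x) (\<gamma> y) (\<gamma> z)) =
       act N x (f' y z) - act N y (f' x z) + act N z (f' x y)
       - f' (lbr H x y) z - f' y (lbr H x z) + f' x (lbr H y z)" .
    note s_eq this }
  ultimately have "(q, t) \<in> cohomologous H N"
    using q transport_ZL3[OF rZ] unfolding t pq(2,3) transport_eq
    by (auto simp: cohomologous_iff intro!: bexI[of _ f'])
  then show "t \<in> HL3_class H N q" by (simp add: HL3_class_def)
qed

text \<open>The missing inclusion is \<open>transport_class_subset\<close> for the inverse
  isomorphism: an element of the class of \<open>q\<close> is the transport of its own transport
  back.\<close>

lemma transport_class: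
  assumes iso: "cocycle_iso G M p H N q \<alpha> \<beta> \<phi>" and p: "p \<in> ZL3 G M" and q: "q \<in> ZL3 H N"
  shows "transport G H \<alpha> \<beta> ` HL3_class G M p = HL3_class H N q"
proof
  interpret I: data_iso H N G M \<gamma> \<delta> by (rule inverse)
  show "HL3_class H N q \<subseteq> transport G H \<alpha> \<beta> ` HL3_class G M p"
  proof
    fix r assume r: "r \<in> HL3_class H N q"
    then have "r \<in> ZL3 H N" by (cases r, cases q) (simp add: HL3_class_def cohomologous_iff)
    then have "r = transport G H \<alpha> \<beta> (transport H G \<gamma> \<delta> r)" by (simp add: transport_inverse)
    moreover have "transport H G \<gamma> \<delta> r \<in> HL3_class G M p"
      using I.transport_class_subset[OF cocycle_iso_inverse[OF assms] q p] r by blast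
    ultimately show "r \<in> transport G H \<alpha> \<beta> ` HL3_class G M p" by blast
  qed
qed (rule transport_class_subset[OF assms])

lemma cocycle_iso_of_transport:
  assumes cl: "transport G H \<alpha> \<beta> ` HL3_class G M p = HL3_class H N q" and p: "p \<in> ZL3 G M"
  shows "\<exists>\<phi>. cocycle_iso G M p H N q \<alpha> \<beta> \<phi>"
proof -
  obtain s j s' j' where pq: "p = (s, j)" "q = (s', j')" by (cases p, cases q)
  \<comment> \<open>Since \<open>p\<close> lies in its own class, its transport lies in the class of
    \<open>q\<close>, which yields a primitive \<open>f\<close> on \<open>H\<close>. Pulled back
    along \<open>\<alpha>\<close> and negated, \<open>f\<close> is the required
    \<open>\<phi>\<close>.\<close>
  have "p \<in> HL3_class G M p" using G.cohomologous_refl[OF p] by (simp add: HL3_class_def)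
  then have "(q, transport G H \<alpha> \<beta> p) \<in> cohomologous H N"
    using cl by (auto simp: HL3_class_def)
  then obtain f where f: "f \<in> Hom2 H N"
    and f1: "\<And>x y. \<lbrakk>x \<in> vcar H; y \<in> vcar H\<rbrakk> \<Longrightarrow> s' x y - \<beta> (s (\<gamma> x) (\<gamma> y)) = f x y + f y x"
    and f2: "\<And>x y z. \<lbrakk>x \<in> vcar H; y \<in> vcar H; z \<in> vcar H\<rbrakk> \<Longrightarrow>
      j' x y z - \<beta> (j (\<gamma> x) (\<gamma> y) (\<gamma> z)) = act N x (f y z) - act N y (f x z) + act N z (f x y)
                  - f (lbr H x y) z - f y (lbr H x z) + f x (lbr H y z)"
    unfolding pq transport_eq by (auto simp: cohomologous_iff)
  have fb: "bilin_map H H N f" using f by (simp add: Hom2_def)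
  note [simp] = bilin_closed[OF fb]
  have "bilin_map G G N (\<lambda>x y. - f (\<alpha> x) (\<alpha> y))"
    using bilin_map_neg[OF bilin_map_compose[OF fb lin(1) lin_map_id]] by simp
  moreover have "\<beta> (s x y) - s' (\<alpha> x) (\<alpha> y) = - f (\<alpha> x) (\<alpha> y) + - f (\<alpha> y) (\<alpha> x)"
    if "x \<in> vcar G" "y \<in> vcar G" for x y
    using f1[of "\<alpha> x" "\<alpha> y"] that by (simp add: algebra_simps)
  moreover have "\<beta> (j x y z) - j' (\<alpha> x) (\<alpha> y) (\<alpha> z) =
      act N (\<alpha> x) (- f (\<alpha> y) (\<alpha> z)) - act N (\<alpha> y) (- f (\<alpha> x) (\<alpha> z)) + act N (\<alpha> z) (- f (\<alpha> x) (\<alpha> y))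
      - (- f (\<alpha> (lbr G x y)) (\<alpha> z)) - (- f (\<alpha> y) (\<alpha> (lbr G x z))) + (- f (\<alpha> x) (\<alpha> (lbr G y z)))"
    if "x \<in> vcar G" "y \<in> vcar G" "z \<in> vcar G" for x y z
    using f2[of "\<alpha> x" "\<alpha> y" "\<alpha> z"] that by (simp add: algebra_simps)
  ultimately show ?thesis
    unfolding cocycle_iso_def pq fst_conv snd_conv using lie_iso rep_iso
    by (intro exI[of _ "\<lambda>x y. - f (\<alpha> x) (\<alpha> y)"]) blast
qed

end

text \<open>Trades the equality of cosets for equations between chosen representatives. The
  equations with \<open>\<phi>\<close> are what morphisms of Lie 2-algebras provide.\<close>

lemma data_isomorphic_iff:
  assumes "lie_module G M" "lie_module H N" "p \<in> ZL3 G M" "q \<in> ZL3 H N"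
  shows "data_isomorphic (G, M, HL3_class G M p) (H, N, HL3_class H N q) \<longleftrightarrow>
    (\<exists>\<alpha> \<beta> \<phi>. cocycle_iso G M p H N q \<alpha> \<beta> \<phi>)"
proof -
  have iso: "data_iso G M H N \<alpha> \<beta>" if "lie_iso G H \<alpha>" "rep_iso G M N \<alpha> \<beta>" for \<alpha> \<beta>
    using assms(1,2) that by (simp add: data_iso_def data_iso_axioms_def)
  have "lie_iso G H \<alpha> \<and> rep_iso G M N \<alpha> \<beta> \<and>
        transport G H \<alpha> \<beta> ` HL3_class G M p = HL3_class H N q \<longleftrightarrow>
      (\<exists>\<phi>. cocycle_iso G M p H N q \<alpha> \<beta> \<phi>)" (is "?l \<longleftrightarrow> ?r") for \<alpha> \<beta>
  proof
    assume ?l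
    then show ?r
      using data_iso.cocycle_iso_of_transport[OF iso _ assms(3)] by blast
  next
    assume ?r
    then obtain \<phi> where \<phi>: "cocycle_iso G M p H N q \<alpha> \<beta> \<phi>" ..
    then have "lie_iso G H \<alpha>" "rep_iso G M N \<alpha> \<beta>" by (simp_all add: cocycle_iso_def)
    then show ?l
      using data_iso.transport_class[OF iso \<phi> assms(3,4)] by simp
  qed
  then show ?thesis
    by (simp only: data_isomorphic_def prod.case)
qed


section \<open>Linear categories\<close>

text \<open>The second component \<open>a\<close> of an arrow written as
  \<open>(x, a)\<close>.\<close>

definition ker_part :: "('k, 'o, 'a::minus, 'e) lincat_scheme \<Rightarrow> 'a \<Rightarrow> 'a" where
  "ker_part V f = f - idt V (src V f)"

context linear_category
begin

lemmas vspaces [simp] = Ob_vspace Ar_vspace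
lemmas src_simps [simp] = lin_map_simps[OF src_linear]
lemmas tgt_simps [simp] = lin_map_simps[OF tgt_linear]
lemmas idt_simps [simp] = lin_map_simps[OF idt_linear]

declare src_idt [simp] tgt_idt [simp]

abbreviation "kp \<equiv> ker_part V"

lemma ker_part_simps [simp]:
  "\<lbrakk>f \<in> vcar (Ar V); g \<in> vcar (Ar V)\<rbrakk> \<Longrightarrow> kp (f + g) = kp f + kp g"
  "\<lbrakk>f \<in> vcar (Ar V); g \<in> vcar (Ar V)\<rbrakk> \<Longrightarrow> kp (f - g) = kp f - kp g"
  "f \<in> vcar (Ar V) \<Longrightarrow> kp (- f) = - kp f"
  "f \<in> vcar (Ar V) \<Longrightarrow> kp (smul (Ar V) c f) = smul (Ar V) c (kp f)"
  "x \<in> vcar (Ob V) \<Longrightarrow> kp (\<iota> x) = 0"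
  "f \<in> vcar (Ar V) \<Longrightarrow> kp f \<in> vcar (Ar V)"
  "f \<in> vcar (Ar V) \<Longrightarrow> src V (kp f) = 0"
  by (simp_all add: ker_part_def vspace_smul_diff)

lemma ker_part_ker [simp]: "src V f = 0 \<Longrightarrow> kp f = f"
  using idt_simps(4) by (simp add: ker_part_def)

lemma ker_part_0 [simp]: "kp 0 = 0"
  using ker_part_simps(5)[of 0] by simp

lemma idt_plus_ker_part: "\<iota> (src V f) + kp f = f"
  by (simp add: ker_part_def)

lemma arrow_eqI: "\<lbrakk>src V f = src V g; kp f = kp g\<rbrakk> \<Longrightarrow> f = g"
  by (metis idt_plus_ker_part)

text \<open>The pair \<open>(g, f)\<close> is the sum of \<open>(g, \<iota> x)\<close> and \<open>(0, f - \<iota> x)\<close>, where \<open>x = tgt f\<close>.\<close>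

lemma comp_eq:
  assumes "composable V g f"
  shows "g \<cdot> f = g + f - \<iota> (tgt V f)"
proof -
  have gf: "g \<in> vcar (Ar V)" "f \<in> vcar (Ar V)" "src V g = tgt V f"
    using assms by (auto simp: composable_def)
  let ?x = "tgt V f"
  have "composable V g (\<iota> ?x)" "composable V 0 (f - \<iota> ?x)"
    using gf by (simp_all add: composable_def)
  from comp_add[OF this] have "g \<cdot> f = (g \<cdot> \<iota> ?x) + (0 \<cdot> (f - \<iota> ?x))" by simp
  moreover have "g \<cdot> \<iota> ?x = g" using comp_idt[of g] gf by simp
  moreover have "0 \<cdot> (f - \<iota> ?x) = f - \<iota> ?x" using idt_comp[of "f - \<iota> ?x"] gf by simp
  ultimately show ?thesis by simp
qed

text \<open>By \<open>comp_eq\<close>, being a left inverse is a linear equation for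
  \<open>g\<close> with exactly one solution. That solution is a two-sided inverse, so every arrow
  of a linear category is invertible.\<close>

lemma inverse_arrows_iff:
  assumes "f \<in> vcar (Ar V)"
  shows "inverse_arrows V f g \<longleftrightarrow> g = \<iota> (src V f) + \<iota> (tgt V f) - f"
proof
  assume "inverse_arrows V f g"
  then have "g + f - \<iota> (tgt V f) = \<iota> (src V f)"
    using comp_eq[of g f] by (simp add: inverse_arrows_def)
  then show "g = \<iota> (src V f) + \<iota> (tgt V f) - f" by (simp add: algebra_simps)
next
  assume g: "g = \<iota> (src V f) + \<iota> (tgt V f) - f"
  then have "composable V g f" "composable V f g"
    using assms by (simp_all add: composable_def)
  then show "inverse_arrows V f g"
    using assms by (simp add: inverse_arrows_def comp_eq) (simp add: g)
qed

lemma inv_arrow_eq: "f \<in> vcar (Ar V) \<Longrightarrow> inv_arrow V f = \<iota> (src V f) + \<iota> (tgt V f) - f"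
  by (simp add: inv_arrow_def inverse_arrows_iff)

text \<open>Every arrow is invertible by \<open>inverse_arrows_iff\<close>, so its source and target
  are isomorphic objects.\<close>

lemma skeletal_iff: "skeletal V \<longleftrightarrow> (\<forall>f\<in>vcar (Ar V). tgt V f = src V f)"
proof
  assume sk: "skeletal V"
  show "\<forall>f\<in>vcar (Ar V). tgt V f = src V f"
  proof
    fix f assume f: "f \<in> vcar (Ar V)"
    then have "isomorphic_objects V (src V f) (tgt V f)"
      unfolding isomorphic_objects_def using inverse_arrows_iff by blast
    with sk f show "tgt V f = src V f"
      unfolding skeletal_def by (metis src_simps(1) tgt_simps(1))
  qed
next
  assume "\<forall>f\<in>vcar (Ar V). tgt V f = src V f"
  then show "skeletal V"
    by (auto simp: skeletal_def isomorphic_objects_def inverse_arrows_def composable_def)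
qed

end

section \<open>The axioms on bracket, \<open>\<S>\<close> and \<open>\<J>\<close> as separate
  rules\<close>

context lie_2_algebra
begin

lemma obr_bilin: "bilin_map (Ob L) (Ob L) (Ob L) (obr L)"
  and abr_bilin: "bilin_map (Ar L) (Ar L) (Ar L) (abr L)"
  and src_abr [simp]: "\<lbrakk>f \<in> vcar (Ar L); g \<in> vcar (Ar L)\<rbrakk> \<Longrightarrow> src L \<lbrakk>f, g\<rbrakk> = \<^bold>[src L f, src L g\<^bold>]"
  and abr_idt [simp]: "\<lbrakk>x \<in> vcar (Ob L); y \<in> vcar (Ob L)\<rbrakk> \<Longrightarrow> \<lbrakk>\<iota> x, \<iota> y\<rbrakk> = \<iota> \<^bold>[x, y\<^bold>]"
  and abr_comp: "\<lbrakk>composable L g f; composable L g' f'\<rbrakk> \<Longrightarrow> \<lbrakk>g \<cdot> f, g' \<cdot> f'\<rbrakk> = \<lbrakk>g, g'\<rbrakk> \<cdot> \<lbrakk>f, f'\<rbrakk>"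
  using bracket_functor unfolding bilinear_functor_def by blast+

lemmas obr_simps [simp] = bilin_simps[OF obr_bilin]
lemmas abr_simps [simp] = bilin_simps[OF abr_bilin]

lemma S_bilin: "bilin_map (Ob L) (Ob L) (Ar L) \<S>"
  and src_S [simp]: "\<lbrakk>x \<in> vcar (Ob L); y \<in> vcar (Ob L)\<rbrakk> \<Longrightarrow> src L (\<S> x y) = \<^bold>[x, y\<^bold>]"
  and tgt_S: "\<lbrakk>x \<in> vcar (Ob L); y \<in> vcar (Ob L)\<rbrakk> \<Longrightarrow> tgt L (\<S> x y) = - \<^bold>[y, x\<^bold>]"
  and S_natural: "\<lbrakk>f \<in> vcar (Ar L); g \<in> vcar (Ar L)\<rbrakk> \<Longrightarrow>
    \<S> (tgt L f) (tgt L g) \<cdot> \<lbrakk>f, g\<rbrakk> = (- \<lbrakk>g, f\<rbrakk>) \<cdot> \<S> (src L f) (src L g)"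
  using S_nat_trans unfolding bilinear_nat_trans_def by blast+

lemma J_trilin: "trilin_map (Ob L) (Ob L) (Ob L) (Ar L) \<J>"
  and src_J [simp]: "\<lbrakk>x \<in> vcar (Ob L); y \<in> vcar (Ob L); z \<in> vcar (Ob L)\<rbrakk>
    \<Longrightarrow> src L (\<J> x y z) = \<^bold>[x, \<^bold>[y, z\<^bold>]\<^bold>]"
  and tgt_J: "\<lbrakk>x \<in> vcar (Ob L); y \<in> vcar (Ob L); z \<in> vcar (Ob L)\<rbrakk>
    \<Longrightarrow> tgt L (\<J> x y z) = \<^bold>[\<^bold>[x, y\<^bold>], z\<^bold>] + \<^bold>[y, \<^bold>[x, z\<^bold>]\<^bold>]"
  and J_natural: "\<lbrakk>f \<in> vcar (Ar L); g \<in> vcar (Ar L); h \<in> vcar (Ar L)\<rbrakk> \<Longrightarrow>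
    \<J> (tgt L f) (tgt L g) (tgt L h) \<cdot> \<lbrakk>f, \<lbrakk>g, h\<rbrakk>\<rbrakk> =
    (\<lbrakk>\<lbrakk>f, g\<rbrakk>, h\<rbrakk> + \<lbrakk>g, \<lbrakk>f, h\<rbrakk>\<rbrakk>) \<cdot> \<J> (src L f) (src L g) (src L h)"
  using J_nat_trans unfolding trilinear_nat_trans_def by blast+

lemmas S_closed [simp] = bilin_closed[OF S_bilin]
lemmas J_closed [simp] = trilin_closed[OF J_trilin]

end

section \<open>Skeletal Lie 2-algebras\<close>

lemma rep_of_simps [simp]:
  "smul (rep_of L) = smul (Ar L)" "vcar (rep_of L) = ker_src L"
  "act (rep_of L) = (\<lambda>x a. abr L (idt L x) a)"
  by (simp_all add: rep_of_def)

lemma lie_alg_of_simps [simp]: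
  "smul (lie_alg_of L) = smul (Ob L)" "vcar (lie_alg_of L) = vcar (Ob L)" "lbr (lie_alg_of L) = obr L"
  by (simp_all add: lie_alg_of_def)

section \<open>Arrows as pairs of a source and an element of the kernel\<close>

locale skeletal_lie_2_algebra = lie_2_algebra +
  assumes skeletal: "skeletal L"
begin

lemma tgt_eq [simp]: "f \<in> vcar (Ar L) \<Longrightarrow> tgt L f = src L f"
  using skeletal by (simp add: skeletal_iff)

text \<open>Composability now means equality of sources, and in \<open>comp_eq\<close> the
  subtracted identity arrow affects only the source. Hence \<open>kp\<close> turns composition into
  addition.\<close>

lemma
  assumes "g \<in> vcar (Ar L)" "f \<in> vcar (Ar L)" "src L g = src L f"
  shows comp_in [simp]: "g \<cdot> f \<in> vcar (Ar L)"
    and src_comp' [simp]: "src L (g \<cdot> f) = src L f"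
    and ker_part_comp [simp]: "kp (g \<cdot> f) = kp g + kp f"
  using assms by (simp_all add: comp_eq composable_def)

lemma inv_arrow_simps [simp]:
  assumes "f \<in> vcar (Ar L)"
  shows "inv_arrow L f \<in> vcar (Ar L)" "src L (inv_arrow L f) = src L f" "kp (inv_arrow L f) = - kp f"
  using assms by (simp_all add: inv_arrow_eq)

text \<open>The two sides are source and target of \<open>\<S> x y\<close>. The Leibniz rule below
  follows from \<open>\<J> x y z\<close> in the same way.\<close>

lemma obr_antisym: "\<lbrakk>x \<in> vcar (Ob L); y \<in> vcar (Ob L)\<rbrakk> \<Longrightarrow> \<^bold>[x, y\<^bold>] = - \<^bold>[y, x\<^bold>]"
  using tgt_S[of x y] by simp

lemma obr_Leibniz:
  "\<lbrakk>x \<in> vcar (Ob L); y \<in> vcar (Ob L); z \<in> vcar (Ob L)\<rbrakk> \<Longrightarrow>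
    \<^bold>[x, \<^bold>[y, z\<^bold>]\<^bold>] = \<^bold>[\<^bold>[x, y\<^bold>], z\<^bold>] + \<^bold>[y, \<^bold>[x, z\<^bold>]\<^bold>]"
  using tgt_J[of x y z] by simp

text \<open>In the naturality square of \<open>\<S>\<close> the same component of
  \<open>\<S>\<close> stands on both sides, as sources equal targets, and its kernel part
  cancels.\<close>

lemma abr_antisym:
  assumes "f \<in> vcar (Ar L)" "g \<in> vcar (Ar L)"
  shows "\<lbrakk>f, g\<rbrakk> = - \<lbrakk>g, f\<rbrakk>"
proof (rule arrow_eqI)
  have eq: "\<^bold>[src L f, src L g\<^bold>] = - \<^bold>[src L g, src L f\<^bold>]"
    using assms by (intro obr_antisym) auto
  then show "src L \<lbrakk>f, g\<rbrakk> = src L (- \<lbrakk>g, f\<rbrakk>)" using assms by simp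
  show "kp \<lbrakk>f, g\<rbrakk> = kp (- \<lbrakk>g, f\<rbrakk>)"
    using arg_cong[OF S_natural[of f g], of kp] assms eq[symmetric] by simp
qed

text \<open>The argument of \<open>abr_antisym\<close> with the naturality square of
  \<open>\<J>\<close>.\<close>

lemma abr_Leibniz:
  assumes "f \<in> vcar (Ar L)" "g \<in> vcar (Ar L)" "h \<in> vcar (Ar L)"
  shows "\<lbrakk>f, \<lbrakk>g, h\<rbrakk>\<rbrakk> = \<lbrakk>\<lbrakk>f, g\<rbrakk>, h\<rbrakk> + \<lbrakk>g, \<lbrakk>f, h\<rbrakk>\<rbrakk>"
proof (rule arrow_eqI)
  have eq: "\<^bold>[src L f, \<^bold>[src L g, src L h\<^bold>]\<^bold>] =
      \<^bold>[\<^bold>[src L f, src L g\<^bold>], src L h\<^bold>] + \<^bold>[src L g, \<^bold>[src L f, src L h\<^bold>]\<^bold>]"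
    using assms by (intro obr_Leibniz) auto
  then show "src L \<lbrakk>f, \<lbrakk>g, h\<rbrakk>\<rbrakk> = src L (\<lbrakk>\<lbrakk>f, g\<rbrakk>, h\<rbrakk> + \<lbrakk>g, \<lbrakk>f, h\<rbrakk>\<rbrakk>)" using assms by simp
  show "kp \<lbrakk>f, \<lbrakk>g, h\<rbrakk>\<rbrakk> = kp (\<lbrakk>\<lbrakk>f, g\<rbrakk>, h\<rbrakk> + \<lbrakk>g, \<lbrakk>f, h\<rbrakk>\<rbrakk>)"
    using arg_cong[OF J_natural[of f g h], of kp] assms eq[symmetric] by simp
qed

lemma ker_src_iff [simp]: "a \<in> ker_src L \<longleftrightarrow> a \<in> vcar (Ar L) \<and> src L a = 0"
  by (auto simp: ker_src_def)

text \<open>An interchange argument: \<open>a\<close> is \<open>a\<close> after \<open>0\<close> and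
  \<open>b\<close> is \<open>0\<close> after \<open>b\<close>, so by functoriality the bracket is a
  composite of \<open>\<lbrakk>a, 0\<rbrakk>\<close> and \<open>\<lbrakk>0, b\<rbrakk>\<close>, both
  zero.\<close>

lemma abr_ker:
  assumes "a \<in> ker_src L" "b \<in> ker_src L"
  shows "\<lbrakk>a, b\<rbrakk> = 0"
proof -
  have "a \<cdot> 0 = a" "0 \<cdot> b = b" "0 \<cdot> 0 = 0"
    using assms by (simp_all add: comp_eq composable_def)
  moreover have "composable L a 0" "composable L 0 b"
    using assms by (auto simp: composable_def)
  ultimately show ?thesis
    using abr_comp[of a 0 0 b] assms by simp
qed

lemma abr_ker_idt:
  "\<lbrakk>a \<in> vcar (Ar L); src L a = 0; x \<in> vcar (Ob L)\<rbrakk> \<Longrightarrow> \<lbrakk>a, \<iota> x\<rbrakk> = - \<lbrakk>\<iota> x, a\<rbrakk>"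
  by (rule abr_antisym) simp_all

text \<open>Expand both arrows into identity and kernel part. The product of the kernel parts
  vanishes by \<open>abr_ker\<close>, and antisymmetry moves the identity to the left in the other
  mixed term.\<close>

lemma ker_part_abr [simp]:
  assumes "f \<in> vcar (Ar L)" "g \<in> vcar (Ar L)"
  shows "kp \<lbrakk>f, g\<rbrakk> = \<lbrakk>\<iota> (src L f), kp g\<rbrakk> - \<lbrakk>\<iota> (src L g), kp f\<rbrakk>"
proof -
  have "\<lbrakk>f, g\<rbrakk> = \<lbrakk>\<iota> (src L f) + kp f, \<iota> (src L g) + kp g\<rbrakk>" by (simp add: idt_plus_ker_part)
  also have "\<dots> = \<iota> \<^bold>[src L f, src L g\<^bold>] + \<lbrakk>\<iota> (src L f), kp g\<rbrakk> + \<lbrakk>kp f, \<iota> (src L g)\<rbrakk>"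
    using assms by (simp add: abr_ker)
  finally show ?thesis
    using assms by (simp add: ker_part_def[of L "\<lbrakk>f, g\<rbrakk>"] abr_ker_idt)
qed

section \<open>Lie algebra, representation and cocycle of a skeletal Lie 2-algebra\<close>

text \<open>The Jacobi identity is the Leibniz rule rearranged by antisymmetry, and the action of a
  bracket is given by the Leibniz rule for arrows with two identities among them.\<close>

sublocale data: lie_module "lie_alg_of L" "rep_of L"
proof
  have "vspace (lie_alg_of L)" using Ob_vspace by (simp add: vspace_def)
  moreover have "bilin_map (lie_alg_of L) (lie_alg_of L) (lie_alg_of L) (obr L)"
    using obr_bilin by (simp add: bilin_map_def lin_map_def)
  moreover have "\<^bold>[x, \<^bold>[y, z\<^bold>]\<^bold>] + \<^bold>[y, \<^bold>[z, x\<^bold>]\<^bold>] + \<^bold>[z, \<^bold>[x, y\<^bold>]\<^bold>] = 0"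
    if "x \<in> vcar (Ob L)" "y \<in> vcar (Ob L)" "z \<in> vcar (Ob L)" for x y z
    using obr_Leibniz[OF that] obr_antisym[of z x] obr_antisym[of z "\<^bold>[x, y\<^bold>]"] that by simp
  ultimately show "lie_algebra (lie_alg_of L)"
    unfolding lie_algebra_def lie_alg_of_simps using obr_antisym by blast
next
  have "module.subspace (smul (Ar L)) (ker_src L)"
    by (rule module.subspaceI[OF vspace_module[OF Ar_vspace]]) (simp_all add: vspace_smul_zero)
  then have "vspace (rep_of L)" using Ar_vspace by (simp add: vspace_def)
  moreover have "bilin_map (lie_alg_of L) (rep_of L) (rep_of L) (\<lambda>x a. \<lbrakk>\<iota> x, a\<rbrakk>)"
    by (simp add: bilin_map_def lin_map_def)
  moreover have "\<lbrakk>\<iota> \<^bold>[x, y\<^bold>], a\<rbrakk> = \<lbrakk>\<iota> x, \<lbrakk>\<iota> y, a\<rbrakk>\<rbrakk> - \<lbrakk>\<iota> y, \<lbrakk>\<iota> x, a\<rbrakk>\<rbrakk>"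
    if "x \<in> vcar (Ob L)" "y \<in> vcar (Ob L)" "a \<in> vcar (Ar L)" for x y a
    using abr_Leibniz[of "\<iota> x" "\<iota> y" a] that by simp
  ultimately show "representation (lie_alg_of L) (rep_of L)"
    by (simp add: representation_def)
qed

lemma lin_map_uminus_ker_part: "lin_map (Ar L) (rep_of L) (\<lambda>f. - kp f)"
  by (simp add: lin_map_def vspace_smul_simps)

lemma cochain_of_simps [simp]:
  "\<lbrakk>x \<in> vcar (Ob L); y \<in> vcar (Ob L)\<rbrakk> \<Longrightarrow> fst (cochain_of L) x y = - kp (\<S> x y)"
  "\<lbrakk>x \<in> vcar (Ob L); y \<in> vcar (Ob L); z \<in> vcar (Ob L)\<rbrakk> \<Longrightarrow>
    snd (cochain_of L) x y z = - kp (\<J> x y z)"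
  by (simp_all add: cochain_of_def ker_part_def)

text \<open>Presents the cochain as \<open>\<S>\<close> and \<open>\<J>\<close> followed by the
  linear map \<open>- kp\<close>, so that its multilinearity follows from that of
  \<open>\<S>\<close> and \<open>\<J>\<close>.\<close>

lemma cochain_of_eq:
  "cochain_of L = (pull2 (lie_alg_of L) (\<lambda>x. x) (\<lambda>x y. - kp (\<S> x y)),
                   pull3 (lie_alg_of L) (\<lambda>x. x) (\<lambda>x y z. - kp (\<J> x y z)))"
  by (auto simp: cochain_of_def pull2_def pull3_def ker_part_def fun_eq_iff)

text \<open>Applying \<open>kp\<close> to (L1)-(L4) turns composites into sums and gives the four
  cocycle equations. The sources of the composed arrows match by antisymmetry and the Leibniz rule
  on objects.\<close>

lemma cochain_of_cocycle: "cochain_of L \<in> ZL3 (lie_alg_of L) (rep_of L)"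
proof -
  have id: "lin_map (lie_alg_of L) (Ob L) (\<lambda>x. x)" by (simp add: lin_map_def)
  have "pull2 (lie_alg_of L) (\<lambda>x. x) (\<lambda>x y. - kp (\<S> x y)) \<in> Hom2 (lie_alg_of L) (rep_of L)"
    using bilin_map_compose[OF S_bilin lin_map_id lin_map_uminus_ker_part] id data.vspaces(1)
    by (rule pull2_Hom2)
  moreover
  have "pull3 (lie_alg_of L) (\<lambda>x. x) (\<lambda>x y z. - kp (\<J> x y z)) \<in> Hom3 (lie_alg_of L) (rep_of L)"
    using trilin_map_compose[OF J_trilin lin_map_id lin_map_uminus_ker_part] id data.vspaces(1)
    by (rule pull3_Hom3)
  moreover
  have "\<lbrakk>\<iota> x, - kp (\<J> y z w)\<rbrakk> - \<lbrakk>\<iota> y, - kp (\<J> x z w)\<rbrakk> + \<lbrakk>\<iota> z, - kp (\<J> x y w)\<rbrakk>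
      + - \<lbrakk>\<iota> w, - kp (\<J> x y z)\<rbrakk>
      - - kp (\<J> \<^bold>[x, y\<^bold>] z w) - - kp (\<J> y \<^bold>[x, z\<^bold>] w) - - kp (\<J> y z \<^bold>[x, w\<^bold>])
      + - kp (\<J> x \<^bold>[y, z\<^bold>] w) + - kp (\<J> x z \<^bold>[y, w\<^bold>]) - - kp (\<J> x y \<^bold>[z, w\<^bold>]) = 0"
    if O: "x \<in> vcar (Ob L)" "y \<in> vcar (Ob L)" "z \<in> vcar (Ob L)" "w \<in> vcar (Ob L)" for x y z w
  proof -
    \<comment> \<open>The factors of both sides of (L1). They stay opaque until the equalities of
      sources are known and \<open>kp\<close> has split the composites, and are expanded only
      then.\<close>
    define A where "A = \<lbrakk>\<J> x y z, \<iota> w\<rbrakk> + \<iota> \<^bold>[\<^bold>[y, z\<^bold>], \<^bold>[x, w\<^bold>]\<^bold>] + \<iota> \<^bold>[\<^bold>[x, z\<^bold>], \<^bold>[y, w\<^bold>]\<^bold>] + \<lbrakk>\<iota> z, \<J> x y w\<rbrakk>"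
    define B where "B = \<J> x \<^bold>[y, z\<^bold>] w + \<J> x z \<^bold>[y, w\<^bold>]"
    define C where "C = \<lbrakk>\<iota> x, \<J> y z w\<rbrakk>"
    define A' where "A' = \<iota> \<^bold>[\<^bold>[\<^bold>[x, y\<^bold>], z\<^bold>], w\<^bold>] + \<iota> \<^bold>[z, \<^bold>[\<^bold>[x, y\<^bold>], w\<^bold>]\<^bold>] + \<J> y \<^bold>[x, z\<^bold>] w + \<J> y z \<^bold>[x, w\<^bold>]"
    define B' where "B' = \<J> \<^bold>[x, y\<^bold>] z w + \<lbrakk>\<iota> y, \<J> x z w\<rbrakk>"
    define C' where "C' = \<J> x y \<^bold>[z, w\<^bold>]"
    have in_Ar: "A \<in> vcar (Ar L)" "B \<in> vcar (Ar L)" "C \<in> vcar (Ar L)"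
      "A' \<in> vcar (Ar L)" "B' \<in> vcar (Ar L)" "C' \<in> vcar (Ar L)"
      using O by (simp_all add: A_def B_def C_def A'_def B'_def C'_def)
    have "src L B = src L C"
      using O obr_Leibniz[of y z w] by (simp add: B_def C_def)
    moreover have "src L A = src L B"
      using O obr_Leibniz[of x "\<^bold>[y, z\<^bold>]" w] obr_Leibniz[of x z "\<^bold>[y, w\<^bold>]"] by (simp add: A_def B_def)
    moreover have "src L B' = src L C'"
      using O obr_Leibniz[of x y "\<^bold>[z, w\<^bold>]"] by (simp add: B'_def C'_def)
    moreover have "src L A' = src L B'"
      using O obr_Leibniz[of "\<^bold>[x, y\<^bold>]" z w] obr_Leibniz[of x z w]
        obr_Leibniz[of y "\<^bold>[x, z\<^bold>]" w] obr_Leibniz[of y z "\<^bold>[x, w\<^bold>]"] by (simp add: A'_def B'_def)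
    moreover have "kp (A \<cdot> B \<cdot> C) = kp (A' \<cdot> B' \<cdot> C')"
      using L1[OF O] by (simp add: A_def B_def C_def A'_def B'_def C'_def)
    ultimately have "kp A + (kp B + kp C) = kp A' + (kp B' + kp C')"
      using in_Ar by simp
    then show ?thesis
      using O unfolding A_def B_def C_def A'_def B'_def C'_def by (simp add: algebra_simps)
  qed
  moreover
  have "- kp (\<J> x y z) + - kp (\<J> y x z) = \<lbrakk>\<iota> z, - kp (\<S> x y)\<rbrakk> \<and>
      - kp (\<J> x y z) + - kp (\<J> x z y) =
        \<lbrakk>\<iota> x, - kp (\<S> y z)\<rbrakk> - - kp (\<S> \<^bold>[x, y\<^bold>] z) - - kp (\<S> y \<^bold>[x, z\<^bold>]) \<and>
      - kp (\<S> \<^bold>[x, y\<^bold>] z) = - kp (\<S> z \<^bold>[x, y\<^bold>])"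
    if O: "x \<in> vcar (Ob L)" "y \<in> vcar (Ob L)" "z \<in> vcar (Ob L)" for x y z
  proof (intro conjI)
    \<comment> \<open>The kernel part of \<open>Jhat\<close> is minus that of \<open>\<J>\<close>,
      since inversion negates it and the subtracted identity contributes nothing. The equality of
      sources allows \<open>kp\<close> to split the composite in (L2).\<close>
    have "src L (- Jhat L y x z) = src L \<lbrakk>\<S> x y, \<iota> z\<rbrakk>"
      using O obr_Leibniz[of x y z] by (simp add: Jhat_def)
    then show "- kp (\<J> x y z) + - kp (\<J> y x z) = \<lbrakk>\<iota> z, - kp (\<S> x y)\<rbrakk>"
      using O arg_cong[OF L2[OF O], of kp] by (simp add: Jhat_def algebra_simps)
    have "src L (- \<J> x z y) = src L \<lbrakk>\<iota> x, \<S> y z\<rbrakk>"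
      using O obr_antisym[of y z] by simp
    moreover have "src L (\<S> \<^bold>[x, y\<^bold>] z + \<S> y \<^bold>[x, z\<^bold>]) = src L (\<J> x y z)"
      using O obr_Leibniz[of x y z] by simp
    ultimately show "- kp (\<J> x y z) + - kp (\<J> x z y) =
        \<lbrakk>\<iota> x, - kp (\<S> y z)\<rbrakk> - - kp (\<S> \<^bold>[x, y\<^bold>] z) - - kp (\<S> y \<^bold>[x, z\<^bold>])"
      using O arg_cong[OF L3[OF O], of kp] by (simp add: algebra_simps)
    have "src L (- \<S> \<^bold>[x, y\<^bold>] z) = src L (\<S> z \<^bold>[x, y\<^bold>])"
      using O obr_antisym[of z "\<^bold>[x, y\<^bold>]"] by simp
    then show "- kp (\<S> \<^bold>[x, y\<^bold>] z) = - kp (\<S> z \<^bold>[x, y\<^bold>])"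
      using O arg_cong[OF L4[of z x y], of kp] by simp
  qed
  ultimately show ?thesis
    unfolding cochain_of_eq ZL3_def by (simp add: ract_def eq_neg_iff_add_eq_0)
qed

lemma classifying_data_data_of: "classifying_data (data_of L)"
  using data.lie_algebra data.representation cochain_of_cocycle
  by (simp add: classifying_data_def data_of_def HL3_def HL3_class_def quotientI)

end


section \<open>Morphisms of skeletal Lie 2-algebras\<close>

locale skeletal_pair = L: skeletal_lie_2_algebra L + L': skeletal_lie_2_algebra L'
  for L :: "('k::field, 'o::ab_group_add, 'a::ab_group_add, 'e) lie2_scheme"
    and L' :: "('k, 'p::ab_group_add, 'b::ab_group_add, 'f) lie2_scheme"

locale skeletal_morphism = skeletal_pair L L'
  for L :: "('k::field, 'o::ab_group_add, 'a::ab_group_add, 'e) lie2_scheme"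
    and L' :: "('k, 'p::ab_group_add, 'b::ab_group_add, 'f) lie2_scheme" +
  fixes F :: "('o, 'a, 'p, 'b) lie2_mor"
  assumes morphism: "lie2_morphism L L' F"
begin

lemma F0_lin: "lin_map (Ob L) (Ob L') (F0 F)"
  and F1_lin: "lin_map (Ar L) (Ar L') (F1 F)"
  and src_F1 [simp]: "f \<in> vcar (Ar L) \<Longrightarrow> src L' (F1 F f) = F0 F (src L f)"
  and F1_idt [simp]: "x \<in> vcar (Ob L) \<Longrightarrow> F1 F (idt L x) = idt L' (F0 F x)"
  using morphism unfolding lie2_morphism_def linear_functor_def by blast+

lemmas F0_simps [simp] = lin_map_simps[OF F0_lin]
lemmas F1_simps [simp] = lin_map_simps[OF F1_lin]

lemma F2_bilin: "bilin_map (Ob L) (Ob L) (Ar L') (F2 F)"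
  and src_F2 [simp]: "\<lbrakk>x \<in> vcar (Ob L); y \<in> vcar (Ob L)\<rbrakk> \<Longrightarrow>
    src L' (F2 F x y) = obr L' (F0 F x) (F0 F y)"
  and tgt_F2: "\<lbrakk>x \<in> vcar (Ob L); y \<in> vcar (Ob L)\<rbrakk> \<Longrightarrow> tgt L' (F2 F x y) = F0 F (obr L x y)"
  and F2_natural: "\<lbrakk>f \<in> vcar (Ar L); g \<in> vcar (Ar L)\<rbrakk> \<Longrightarrow>
    F2 F (tgt L f) (tgt L g) \<cdot>\<^bsub>L'\<^esub> abr L' (F1 F f) (F1 F g) =
    F1 F (abr L f g) \<cdot>\<^bsub>L'\<^esub> F2 F (src L f) (src L g)"
  using morphism unfolding lie2_morphism_def bilinear_nat_trans_def by blast+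

lemmas F2_closed [simp] = bilin_closed[OF F2_bilin]

lemma F2_S: "\<lbrakk>x \<in> vcar (Ob L); y \<in> vcar (Ob L)\<rbrakk> \<Longrightarrow>
    F1 F (altr L x y) \<cdot>\<^bsub>L'\<^esub> F2 F x y = (- F2 F y x) \<cdot>\<^bsub>L'\<^esub> altr L' (F0 F x) (F0 F y)"
  and F2_J: "\<lbrakk>x \<in> vcar (Ob L); y \<in> vcar (Ob L); z \<in> vcar (Ob L)\<rbrakk> \<Longrightarrow>
    F1 F (jacr L x y z) \<cdot>\<^bsub>L'\<^esub> F2 F x (obr L y z) \<cdot>\<^bsub>L'\<^esub> abr L' (idt L' (F0 F x)) (F2 F y z)
        = (F2 F (obr L x y) z + F2 F y (obr L x z))
          \<cdot>\<^bsub>L'\<^esub> (abr L' (F2 F x y) (idt L' (F0 F z)) + abr L' (idt L' (F0 F y)) (F2 F x z))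
          \<cdot>\<^bsub>L'\<^esub> jacr L' (F0 F x) (F0 F y) (F0 F z)"
  using morphism unfolding lie2_morphism_def by blast+

text \<open>The two sides are target and source of \<open>F2 F x y\<close>, which agree in a
  skeletal category.\<close>

lemma F0_obr [simp]:
  "\<lbrakk>x \<in> vcar (Ob L); y \<in> vcar (Ob L)\<rbrakk> \<Longrightarrow> F0 F (obr L x y) = obr L' (F0 F x) (F0 F y)"
  using tgt_F2[of x y] by simp

lemma ker_part_F1: "f \<in> vcar (Ar L) \<Longrightarrow> ker_part L' (F1 F f) = F1 F (ker_part L f)"
  by (simp add: ker_part_def)

text \<open>Both sides of the naturality square of \<open>F2\<close> contain the same component of
  \<open>F2\<close>, whose kernel part cancels.\<close>

lemma F1_abr:
  assumes "f \<in> vcar (Ar L)" "g \<in> vcar (Ar L)"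
  shows "F1 F (abr L f g) = abr L' (F1 F f) (F1 F g)"
proof (rule L'.arrow_eqI)
  show "src L' (F1 F (abr L f g)) = src L' (abr L' (F1 F f) (F1 F g))"
    using assms by simp
  have "ker_part L' (F2 F (src L f) (src L g) \<cdot>\<^bsub>L'\<^esub> abr L' (F1 F f) (F1 F g)) =
      ker_part L' (F1 F (abr L f g) \<cdot>\<^bsub>L'\<^esub> F2 F (src L f) (src L g))"
    using F2_natural[OF assms] assms by simp
  then show "ker_part L' (F1 F (abr L f g)) = ker_part L' (abr L' (F1 F f) (F1 F g))"
    using assms by (simp del: L'.ker_part_abr)
qed

text \<open>The equations for the primitive are the kernel parts of the coherence conditions
  \<open>F2_S\<close> and \<open>F2_J\<close>, in which composition has become addition.\<close>

lemma cocycle_iso: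
  assumes "bij_betw (F0 F) (vcar (Ob L)) (vcar (Ob L'))" "bij_betw (F1 F) (ker_src L) (ker_src L')"
  shows "cocycle_iso (lie_alg_of L) (rep_of L) (cochain_of L)
    (lie_alg_of L') (rep_of L') (cochain_of L') (F0 F) (F1 F) (\<lambda>x y. ker_part L' (F2 F x y))"
proof -
  have "lie_iso (lie_alg_of L) (lie_alg_of L') (F0 F)"
    using assms by (simp add: lie_iso_def lin_map_def)
  moreover have "rep_iso (lie_alg_of L) (rep_of L) (rep_of L') (F0 F) (F1 F)"
    using assms by (simp add: rep_iso_def lin_map_def F1_abr)
  moreover have "bilin_map (lie_alg_of L) (lie_alg_of L) (rep_of L') (\<lambda>x y. ker_part L' (F2 F x y))"
    by (simp add: bilin_map_def lin_map_def bilin_simps[OF F2_bilin])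
  moreover have "F1 F (- ker_part L (altr L x y)) - - ker_part L' (altr L' (F0 F x) (F0 F y)) =
      ker_part L' (F2 F x y) + ker_part L' (F2 F y x)"
    if O: "x \<in> vcar (Ob L)" "y \<in> vcar (Ob L)" for x y
  proof -
    have "src L' (- F2 F y x) = src L' (altr L' (F0 F x) (F0 F y))"
      using O L'.obr_antisym[of "F0 F x" "F0 F y"] by simp
    then show ?thesis
      using O arg_cong[OF F2_S[OF O], of "ker_part L'"] by (simp add: ker_part_F1 algebra_simps)
  qed
  moreover have "F1 F (- ker_part L (jacr L x y z)) - - ker_part L' (jacr L' (F0 F x) (F0 F y) (F0 F z)) =
      abr L' (idt L' (F0 F x)) (ker_part L' (F2 F y z)) -
      abr L' (idt L' (F0 F y)) (ker_part L' (F2 F x z)) +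
      abr L' (idt L' (F0 F z)) (ker_part L' (F2 F x y)) -
      ker_part L' (F2 F (obr L x y) z) - ker_part L' (F2 F y (obr L x z)) +
      ker_part L' (F2 F x (obr L y z))"
    if O: "x \<in> vcar (Ob L)" "y \<in> vcar (Ob L)" "z \<in> vcar (Ob L)" for x y z
  proof -
    define A where "A = F2 F (obr L x y) z + F2 F y (obr L x z)"
    define B where "B = abr L' (F2 F x y) (idt L' (F0 F z)) + abr L' (idt L' (F0 F y)) (F2 F x z)"
    have AB: "A \<in> vcar (Ar L')" "B \<in> vcar (Ar L')" "src L' A = src L' B"
      "src L' B = src L' (jacr L' (F0 F x) (F0 F y) (F0 F z))"
      using O L'.obr_Leibniz[of "F0 F x" "F0 F y" "F0 F z"] by (simp_all add: A_def B_def)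
    have "ker_part L' (F1 F (jacr L x y z)) + (ker_part L' (F2 F x (obr L y z)) +
        abr L' (idt L' (F0 F x)) (ker_part L' (F2 F y z))) =
        ker_part L' A + (ker_part L' B + ker_part L' (jacr L' (F0 F x) (F0 F y) (F0 F z)))"
      using O AB arg_cong[OF F2_J[OF O, folded A_def B_def], of "ker_part L'"] by simp
    then show ?thesis
      using O by (simp add: A_def B_def ker_part_F1 algebra_simps)
  qed
  ultimately show ?thesis
    by (simp add: cocycle_iso_def)
qed

end

text \<open>The arrow \<open>\<Theta> x\<close> runs from \<open>F0 G (F0 F x)\<close> to
  \<open>x\<close>, so these objects are equal. In the naturality square at \<open>f\<close> the
  kernel part of \<open>\<Theta> (src L f)\<close> then occurs on both sides and cancels.\<close>

lemma (in skeletal_lie_2_algebra) iso_id_cancel: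
  assumes \<Theta>: "invertible_2morphism L L (lie2_comp L G F) (lie2_id L) \<Theta>"
    and "skeletal_morphism L L' F" "skeletal_morphism L' L G"
  shows "x \<in> vcar (Ob L) \<Longrightarrow> F0 G (F0 F x) = x" "f \<in> vcar (Ar L) \<Longrightarrow> F1 G (F1 F f) = f"
proof -
  interpret F: skeletal_morphism L L' F by fact
  interpret G: skeletal_morphism L' L G by fact
  have lin: "lin_map (Ob L) (Ar L) \<Theta>"
    and src: "\<And>x. x \<in> vcar (Ob L) \<Longrightarrow> src L (\<Theta> x) = F0 G (F0 F x)"
    and tgt: "\<And>x. x \<in> vcar (Ob L) \<Longrightarrow> tgt L (\<Theta> x) = x"
    and nat: "\<And>f. f \<in> vcar (Ar L) \<Longrightarrow> \<Theta> (tgt L f) \<cdot> F1 G (F1 F f) = f \<cdot> \<Theta> (src L f)"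
    using \<Theta> by (simp_all add: invertible_2morphism_def lie2_2morphism_def linear_nat_trans_def
        lie2_comp_def lie2_id_def)
  note [simp] = lin_map_closed[OF lin]
  show GF0: "F0 G (F0 F x) = x" if "x \<in> vcar (Ob L)" for x
    using src[OF that] tgt[OF that] that by simp
  show "F1 G (F1 F f) = f" if f: "f \<in> vcar (Ar L)" for f
  proof (rule arrow_eqI)
    show "src L (F1 G (F1 F f)) = src L f" using f by (simp add: GF0)
    show "kp (F1 G (F1 F f)) = kp f"
      using arg_cong[OF nat[OF f], of kp] f by (simp add: GF0 src)
  qed
qed

context skeletal_pair
begin

lemma cocycle_iso_of_equivalence:
  assumes "lie2_equivalence L L' F"
  shows "cocycle_iso (lie_alg_of L) (rep_of L) (cochain_of L)
    (lie_alg_of L') (rep_of L') (cochain_of L') (F0 F) (F1 F) (\<lambda>x y. ker_part L' (F2 F x y))"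
proof -
  obtain G \<Theta> \<Theta>' where F: "lie2_morphism L L' F" and G: "lie2_morphism L' L G"
    and \<Theta>: "invertible_2morphism L L (lie2_comp L G F) (lie2_id L) \<Theta>"
    and \<Theta>': "invertible_2morphism L' L' (lie2_comp L' F G) (lie2_id L') \<Theta>'"
    using assms unfolding lie2_equivalence_def by blast
  interpret F: skeletal_morphism L L' F by unfold_locales fact
  interpret G: skeletal_morphism L' L G by unfold_locales fact
  note GF = L.iso_id_cancel[OF \<Theta> F.skeletal_morphism_axioms G.skeletal_morphism_axioms]
  note FG = L'.iso_id_cancel[OF \<Theta>' G.skeletal_morphism_axioms F.skeletal_morphism_axioms]
  show ?thesis
    by (rule F.cocycle_iso; rule bij_betw_byWitness[where f' = "F0 G"] bij_betw_byWitness[where f' = "F1 G"])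
      (auto simp: GF FG)
qed

end

section \<open>Equivalences from isomorphisms of cocycles\<close>

text \<open>On arrows this is \<open>(x, a) \<mapsto> (\<alpha> x, \<beta> a)\<close>, and
  \<open>\<phi>\<close> is the kernel part of \<open>F2\<close>. Since \<open>\<beta>\<close> is
  linear on the kernel of the source only, it is applied to \<open>ker_part L f\<close>.\<close>

definition mor_of ::
  "('k, 'o, 'a::ab_group_add, 'e) lie2_scheme \<Rightarrow> ('k, 'p, 'b::ab_group_add, 'f) lie2_scheme \<Rightarrow>
   ('o \<Rightarrow> 'p) \<Rightarrow> ('a \<Rightarrow> 'b) \<Rightarrow> ('o \<Rightarrow> 'o \<Rightarrow> 'b) \<Rightarrow> ('o, 'a, 'p, 'b) lie2_mor"
where
  "mor_of L L' \<alpha> \<beta> \<phi> =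
     \<lparr>F0 = \<alpha>, F1 = (\<lambda>f. idt L' (\<alpha> (src L f)) + \<beta> (ker_part L f)),
      F2 = (\<lambda>x y. idt L' (\<alpha> (obr L x y)) + \<phi> x y)\<rparr>"

lemma mor_of_simps [simp]:
  "F0 (mor_of L L' \<alpha> \<beta> \<phi>) = \<alpha>"
  "F1 (mor_of L L' \<alpha> \<beta> \<phi>) f = idt L' (\<alpha> (src L f)) + \<beta> (ker_part L f)"
  "F2 (mor_of L L' \<alpha> \<beta> \<phi>) x y = idt L' (\<alpha> (obr L x y)) + \<phi> x y"
  by (simp_all add: mor_of_def)

locale skeletal_cocycle_iso = skeletal_pair L L'
  for L :: "('k::field, 'o::ab_group_add, 'a::ab_group_add, 'e) lie2_scheme"
    and L' :: "('k, 'p::ab_group_add, 'b::ab_group_add, 'f) lie2_scheme" +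
  fixes \<alpha> :: "'o \<Rightarrow> 'p" and \<beta> :: "'a \<Rightarrow> 'b" and \<phi> :: "'o \<Rightarrow> 'o \<Rightarrow> 'b"
  assumes cocycle_iso: "cocycle_iso (lie_alg_of L) (rep_of L) (cochain_of L)
    (lie_alg_of L') (rep_of L') (cochain_of L') \<alpha> \<beta> \<phi>"
begin

lemma isos: "lie_iso (lie_alg_of L) (lie_alg_of L') \<alpha>"
    "rep_iso (lie_alg_of L) (rep_of L) (rep_of L') \<alpha> \<beta>"
  and \<phi>_bilin: "bilin_map (lie_alg_of L) (lie_alg_of L) (rep_of L') \<phi>"
  using cocycle_iso by (auto simp: cocycle_iso_def)

lemma \<alpha>_lin: "lin_map (Ob L) (Ob L') \<alpha>"
  using isos(1) by (simp add: lie_iso_def lin_map_def)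

lemma \<beta>_lin: "lin_map (rep_of L) (rep_of L') \<beta>"
  using isos(2) by (simp add: rep_iso_def)

lemmas \<alpha>_simps [simp] = lin_map_simps[OF \<alpha>_lin]

lemma \<alpha>_obr [simp]: "\<lbrakk>x \<in> vcar (Ob L); y \<in> vcar (Ob L)\<rbrakk> \<Longrightarrow> \<alpha> (obr L x y) = obr L' (\<alpha> x) (\<alpha> y)"
  using isos(1) by (simp add: lie_iso_def)

lemma \<beta>_closed [simp]: "\<lbrakk>a \<in> vcar (Ar L); src L a = 0\<rbrakk> \<Longrightarrow> \<beta> a \<in> vcar (Ar L')"
  and src_\<beta> [simp]: "\<lbrakk>a \<in> vcar (Ar L); src L a = 0\<rbrakk> \<Longrightarrow> src L' (\<beta> a) = 0"
  using lin_map_closed[OF \<beta>_lin] by auto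

lemma \<beta>_simps [simp]:
  "\<lbrakk>a \<in> vcar (Ar L); src L a = 0; b \<in> vcar (Ar L); src L b = 0\<rbrakk> \<Longrightarrow> \<beta> (a + b) = \<beta> a + \<beta> b"
  "\<lbrakk>a \<in> vcar (Ar L); src L a = 0; b \<in> vcar (Ar L); src L b = 0\<rbrakk> \<Longrightarrow> \<beta> (a - b) = \<beta> a - \<beta> b"
  "\<lbrakk>a \<in> vcar (Ar L); src L a = 0\<rbrakk> \<Longrightarrow> \<beta> (- a) = - \<beta> a"
  "\<lbrakk>a \<in> vcar (Ar L); src L a = 0\<rbrakk> \<Longrightarrow> \<beta> (smul (Ar L) c a) = smul (Ar L') c (\<beta> a)"
  "\<beta> 0 = 0"
  using lin_map_simps[OF \<beta>_lin] L.data.vspaces(2) by auto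

lemma \<beta>_act [simp]: "\<lbrakk>x \<in> vcar (Ob L); a \<in> vcar (Ar L); src L a = 0\<rbrakk> \<Longrightarrow>
    \<beta> (abr L (idt L x) a) = abr L' (idt L' (\<alpha> x)) (\<beta> a)"
  using isos(2) by (simp add: rep_iso_def)

lemma \<phi>_closed [simp]: "\<lbrakk>x \<in> vcar (Ob L); y \<in> vcar (Ob L)\<rbrakk> \<Longrightarrow> \<phi> x y \<in> vcar (Ar L')"
  and src_\<phi> [simp]: "\<lbrakk>x \<in> vcar (Ob L); y \<in> vcar (Ob L)\<rbrakk> \<Longrightarrow> src L' (\<phi> x y) = 0"
  using bilin_closed[OF \<phi>_bilin] by auto

lemma \<phi>_bilin': "bilin_map (Ob L) (Ob L) (Ar L') \<phi>"
  using \<phi>_bilin by (simp add: bilin_map_def lin_map_def)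

text \<open>Equations between arrows are checked on source and kernel part. The kernel parts of the
  two coherence conditions are the equations of \<open>cocycle_iso\<close>.\<close>

lemma mor_of_morphism: "lie2_morphism L L' (mor_of L L' \<alpha> \<beta> \<phi>)"
  unfolding lie2_morphism_def
proof (intro conjI ballI)
  let ?F1 = "\<lambda>f. idt L' (\<alpha> (src L f)) + \<beta> (ker_part L f)"
  let ?F2 = "\<lambda>x y. idt L' (\<alpha> (obr L x y)) + \<phi> x y"
  have "?F1 (g \<cdot>\<^bsub>L\<^esub> f) = ?F1 g \<cdot>\<^bsub>L'\<^esub> ?F1 f" if "composable L g f" for g f
    by (rule L'.arrow_eqI; use that in \<open>simp add: composable_def\<close>)
  then show "linear_functor L L' (F0 (mor_of L L' \<alpha> \<beta> \<phi>)) (F1 (mor_of L L' \<alpha> \<beta> \<phi>))"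
    unfolding linear_functor_def by (simp add: \<alpha>_lin) (simp add: lin_map_def vspace_smul_simps)
  \<comment> \<open>In kernel parts, \<open>\<phi>\<close> enters both sides alike, and what remains
    is the compatibility of \<open>\<beta>\<close> with the actions.\<close>
  have "?F2 (src L f) (src L g) \<cdot>\<^bsub>L'\<^esub> abr L' (?F1 f) (?F1 g) =
      ?F1 (abr L f g) \<cdot>\<^bsub>L'\<^esub> ?F2 (src L f) (src L g)"
    if "f \<in> vcar (Ar L)" "g \<in> vcar (Ar L)" for f g
    by (rule L'.arrow_eqI; use that in \<open>simp add: L'.abr_ker L'.abr_ker_idt\<close>)
  moreover have "bilin_map (Ob L) (Ob L) (Ar L') ?F2"
    using bilin_map_add[OF bilin_map_compose[OF L.obr_bilin lin_map_id \<alpha>_lin, THEN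
          bilin_map_compose[OF _ lin_map_id L'.idt_linear]] \<phi>_bilin'] by simp
  ultimately show "bilinear_nat_trans L L'
       (\<lambda>x y. obr L' (F0 (mor_of L L' \<alpha> \<beta> \<phi>) x) (F0 (mor_of L L' \<alpha> \<beta> \<phi>) y))
       (\<lambda>f g. abr L' (F1 (mor_of L L' \<alpha> \<beta> \<phi>) f) (F1 (mor_of L L' \<alpha> \<beta> \<phi>) g))
       (\<lambda>x y. F0 (mor_of L L' \<alpha> \<beta> \<phi>) (obr L x y)) (\<lambda>f g. F1 (mor_of L L' \<alpha> \<beta> \<phi>) (abr L f g))
       (F2 (mor_of L L' \<alpha> \<beta> \<phi>))"
    by (simp add: bilinear_nat_trans_def mor_of_def)
next
  let ?F = "mor_of L L' \<alpha> \<beta> \<phi>"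
  fix x y assume O: "x \<in> vcar (Ob L)" "y \<in> vcar (Ob L)"
  \<comment> \<open>The sources of \<open>A\<close> and \<open>B\<close> agree only up to
    antisymmetry in \<open>L'\<close>. Recording this for opaque names lets
    \<open>ker_part L'\<close> split the composite before the factors are expanded; the next case
    does the same with the Leibniz rule.\<close>
  define A where "A = - F2 ?F y x"
  define B where "B = altr L' (F0 ?F x) (F0 ?F y)"
  have AB: "A \<in> vcar (Ar L')" "B \<in> vcar (Ar L')" "src L' A = src L' B"
      "src L' B = obr L' (\<alpha> x) (\<alpha> y)"
    using O L'.obr_antisym[of "\<alpha> x" "\<alpha> y"] by (simp_all add: A_def B_def)
  have "F1 ?F (altr L x y) \<cdot>\<^bsub>L'\<^esub> F2 ?F x y = A \<cdot>\<^bsub>L'\<^esub> B"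
  proof (rule L'.arrow_eqI)
    show "src L' (F1 ?F (altr L x y) \<cdot>\<^bsub>L'\<^esub> F2 ?F x y) = src L' (A \<cdot>\<^bsub>L'\<^esub> B)"
      using O AB by simp
    have "ker_part L' (A \<cdot>\<^bsub>L'\<^esub> B) = ker_part L' A + ker_part L' B"
      using AB by simp
    then show "ker_part L' (F1 ?F (altr L x y) \<cdot>\<^bsub>L'\<^esub> F2 ?F x y) = ker_part L' (A \<cdot>\<^bsub>L'\<^esub> B)"
      using O cocycle_isoD(1)[OF cocycle_iso, of x y] by (simp add: A_def B_def algebra_simps)
  qed
  then show "F1 ?F (altr L x y) \<cdot>\<^bsub>L'\<^esub> F2 ?F x y = (- F2 ?F y x) \<cdot>\<^bsub>L'\<^esub> altr L' (F0 ?F x) (F0 ?F y)"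
    by (simp only: A_def B_def)
next
  let ?F = "mor_of L L' \<alpha> \<beta> \<phi>"
  fix x y z assume O: "x \<in> vcar (Ob L)" "y \<in> vcar (Ob L)" "z \<in> vcar (Ob L)"
  define A where "A = F2 ?F (obr L x y) z + F2 ?F y (obr L x z)"
  define B where "B = abr L' (F2 ?F x y) (idt L' (F0 ?F z)) + abr L' (idt L' (F0 ?F y)) (F2 ?F x z)"
  define C where "C = jacr L' (F0 ?F x) (F0 ?F y) (F0 ?F z)"
  have AB: "A \<in> vcar (Ar L')" "B \<in> vcar (Ar L')" "C \<in> vcar (Ar L')" "src L' A = src L' B"
      "src L' B = src L' C" "src L' C = obr L' (\<alpha> x) (obr L' (\<alpha> y) (\<alpha> z))"
    using O L'.obr_Leibniz[of "\<alpha> x" "\<alpha> y" "\<alpha> z"] by (simp_all add: A_def B_def C_def)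
  have "F1 ?F (jacr L x y z) \<cdot>\<^bsub>L'\<^esub> F2 ?F x (obr L y z) \<cdot>\<^bsub>L'\<^esub> abr L' (idt L' (F0 ?F x)) (F2 ?F y z)
      = A \<cdot>\<^bsub>L'\<^esub> B \<cdot>\<^bsub>L'\<^esub> C"
  proof (rule L'.arrow_eqI)
    show "src L' (F1 ?F (jacr L x y z) \<cdot>\<^bsub>L'\<^esub> F2 ?F x (obr L y z) \<cdot>\<^bsub>L'\<^esub>
        abr L' (idt L' (F0 ?F x)) (F2 ?F y z)) = src L' (A \<cdot>\<^bsub>L'\<^esub> B \<cdot>\<^bsub>L'\<^esub> C)"
      using O AB by simp
    have "ker_part L' (A \<cdot>\<^bsub>L'\<^esub> B \<cdot>\<^bsub>L'\<^esub> C) = ker_part L' A + (ker_part L' B + ker_part L' C)"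
      using AB by simp
    then show "ker_part L' (F1 ?F (jacr L x y z) \<cdot>\<^bsub>L'\<^esub> F2 ?F x (obr L y z) \<cdot>\<^bsub>L'\<^esub>
        abr L' (idt L' (F0 ?F x)) (F2 ?F y z)) = ker_part L' (A \<cdot>\<^bsub>L'\<^esub> B \<cdot>\<^bsub>L'\<^esub> C)"
      using O cocycle_isoD(2)[OF cocycle_iso, of x y z] by (simp add: A_def B_def C_def L'.abr_ker_idt algebra_simps)
  qed
  then show "F1 ?F (jacr L x y z) \<cdot>\<^bsub>L'\<^esub> F2 ?F x (obr L y z) \<cdot>\<^bsub>L'\<^esub> abr L' (idt L' (F0 ?F x)) (F2 ?F y z)
        = (F2 ?F (obr L x y) z + F2 ?F y (obr L x z))
          \<cdot>\<^bsub>L'\<^esub> (abr L' (F2 ?F x y) (idt L' (F0 ?F z)) + abr L' (idt L' (F0 ?F y)) (F2 ?F x z))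
          \<cdot>\<^bsub>L'\<^esub> jacr L' (F0 ?F x) (F0 ?F y) (F0 ?F z)"
    by (simp only: A_def B_def C_def)
qed

end

text \<open>\<open>H\<close> need not equal \<open>lie2_id L\<close> as a record, because its
  functions are free off the carriers. Identity arrows then form a 2-morphism that is its own
  inverse.\<close>

lemma (in skeletal_lie_2_algebra) idt_invertible_2morphism:
  assumes F0: "\<And>x. x \<in> vcar (Ob L) \<Longrightarrow> F0 H x = x"
    and F1: "\<And>f. f \<in> vcar (Ar L) \<Longrightarrow> F1 H f = f"
    and F2: "\<And>x y. \<lbrakk>x \<in> vcar (Ob L); y \<in> vcar (Ob L)\<rbrakk> \<Longrightarrow> F2 H x y = \<iota> \<^bold>[x, y\<^bold>]"
  shows "invertible_2morphism L L H (lie2_id L) \<iota>"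
proof -
  have "\<iota> x \<cdot> \<iota> x = \<iota> x" if "x \<in> vcar (Ob L)" for x
    using that by (simp add: comp_eq composable_def)
  moreover have "\<iota> (src L f) \<cdot> f = f" "f \<cdot> \<iota> (src L f) = f" if "f \<in> vcar (Ar L)" for f
    using that by (simp_all add: comp_eq composable_def)
  ultimately show ?thesis
    by (auto simp: invertible_2morphism_def lie2_2morphism_def linear_nat_trans_def lie2_id_def
        idt_linear F0 F1 F2 intro!: exI[of _ \<iota>])
qed

text \<open>The kernel part of the \<open>F2\<close> of the composite is
  \<open>\<beta>' (\<phi> x y) + \<phi>' (\<alpha> x) (\<alpha> y)\<close>, so the third condition
  makes it an identity arrow.\<close>

lemma (in skeletal_cocycle_iso) comp_mor_of_invertible:
  assumes "skeletal_cocycle_iso L' L \<alpha>' \<beta>' \<phi>'"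
    and inv: "\<And>x. x \<in> vcar (Ob L) \<Longrightarrow> \<alpha>' (\<alpha> x) = x" "\<And>a. a \<in> ker_src L \<Longrightarrow> \<beta>' (\<beta> a) = a"
      "\<And>x y. \<lbrakk>x \<in> vcar (Ob L); y \<in> vcar (Ob L)\<rbrakk> \<Longrightarrow> \<phi>' (\<alpha> x) (\<alpha> y) = - \<beta>' (\<phi> x y)"
  shows "invertible_2morphism L L (lie2_comp L (mor_of L' L \<alpha>' \<beta>' \<phi>') (mor_of L L' \<alpha> \<beta> \<phi>))
    (lie2_id L) (idt L)"
proof (rule L.idt_invertible_2morphism)
  interpret I: skeletal_cocycle_iso L' L \<alpha>' \<beta>' \<phi>' by fact
  let ?H = "lie2_comp L (mor_of L' L \<alpha>' \<beta>' \<phi>') (mor_of L L' \<alpha> \<beta> \<phi>)"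
  show "F0 ?H x = x" if "x \<in> vcar (Ob L)" for x
    using that by (simp add: lie2_comp_def inv)
  show "F1 ?H f = f" if "f \<in> vcar (Ar L)" for f
    using that by (simp add: lie2_comp_def inv L.idt_plus_ker_part)
  show "F2 ?H x y = idt L (obr L x y)" if "x \<in> vcar (Ob L)" "y \<in> vcar (Ob L)" for x y
    by (rule L.arrow_eqI; use that in \<open>simp add: lie2_comp_def inv\<close>)
qed

context skeletal_pair
begin

lemma equivalent_of_cocycle_iso:
  assumes iso: "cocycle_iso (lie_alg_of L) (rep_of L) (cochain_of L)
    (lie_alg_of L') (rep_of L') (cochain_of L') \<alpha> \<beta> \<phi>"
  shows "lie2_equivalent L L'"
proof -
  interpret F: skeletal_cocycle_iso L L' \<alpha> \<beta> \<phi> by unfold_locales fact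
  interpret D: data_iso "lie_alg_of L" "rep_of L" "lie_alg_of L'" "rep_of L'" \<alpha> \<beta>
    by unfold_locales (fact F.isos)+
  let ?\<gamma> = "inv_into (vcar (Ob L)) \<alpha>" and ?\<delta> = "inv_into (ker_src L) \<beta>"
  \<comment> \<open>The primitive from \<open>cocycle_iso_inverse\<close>. As
    \<open>?\<gamma>\<close> and \<open>?\<delta>\<close> invert \<open>\<alpha>\<close> and
    \<open>\<beta>\<close>, it satisfies the third condition of
    \<open>comp_mor_of_invertible\<close> for both composites.\<close>
  let ?\<psi> = "\<lambda>x y. - ?\<delta> (\<phi> (?\<gamma> x) (?\<gamma> y))"
  interpret G: skeletal_cocycle_iso L' L ?\<gamma> ?\<delta> ?\<psi>
    using D.cocycle_iso_inverse[OF iso L.cochain_of_cocycle L'.cochain_of_cocycle]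
    by unfold_locales simp
  note inv = D.inverse_simps[simplified]
  have "invertible_2morphism L L (lie2_comp L (mor_of L' L ?\<gamma> ?\<delta> ?\<psi>) (mor_of L L' \<alpha> \<beta> \<phi>))
      (lie2_id L) (idt L)"
    by (rule F.comp_mor_of_invertible[OF G.skeletal_cocycle_iso_axioms]) (simp_all add: inv)
  moreover
  have "invertible_2morphism L' L' (lie2_comp L' (mor_of L L' \<alpha> \<beta> \<phi>) (mor_of L' L ?\<gamma> ?\<delta> ?\<psi>))
      (lie2_id L') (idt L')"
    by (rule G.comp_mor_of_invertible[OF F.skeletal_cocycle_iso_axioms]) (simp_all add: inv)
  ultimately show ?thesis
    unfolding lie2_equivalent_def lie2_equivalence_def
    using F.mor_of_morphism G.mor_of_morphism by blast
qed

lemma equivalent_iff: "lie2_equivalent L L' \<longleftrightarrow> data_isomorphic (data_of L) (data_of L')"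
  unfolding data_of_def
    data_isomorphic_iff[OF L.data.lie_module_axioms L'.data.lie_module_axioms
      L.cochain_of_cocycle L'.cochain_of_cocycle]
  using equivalent_of_cocycle_iso cocycle_iso_of_equivalence
  unfolding lie2_equivalent_def by blast

end


section \<open>The skeletal Lie 2-algebra of a cocycle\<close>

context lie_module
begin

text \<open>The Jacobi identity with two terms turned by antisymmetry. The sum on the left is the
  target required of the Jacobiator of \<open>lie2_of\<close>, the right side its source.\<close>

lemma Leibniz:
  assumes "x \<in> vcar G" "y \<in> vcar G" "z \<in> vcar G"
  shows "lbr G (lbr G x y) z + lbr G y (lbr G x z) = lbr G x (lbr G y z)"
proof -
  have anti: "lbr G a b = - lbr G b a" if "a \<in> vcar G" "b \<in> vcar G" for a b
    using that lie_algebra unfolding lie_algebra_def by blast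
  have "lbr G x (lbr G y z) + lbr G y (lbr G z x) + lbr G z (lbr G x y) = 0"
    using assms lie_algebra unfolding lie_algebra_def by blast
  moreover have "lbr G y (lbr G z x) = - lbr G y (lbr G x z)"
    using anti[of z x] assms by simp
  moreover have "lbr G z (lbr G x y) = - lbr G (lbr G x y) z"
    using anti[of z "lbr G x y"] assms by simp
  ultimately show ?thesis by (simp add: algebra_simps)
qed

lemma antisym: "\<lbrakk>x \<in> vcar G; y \<in> vcar G\<rbrakk> \<Longrightarrow> - lbr G y x = lbr G x y"
  using lie_algebra unfolding lie_algebra_def by metis

lemma act_lbr:
  "\<lbrakk>x \<in> vcar G; y \<in> vcar G; m \<in> vcar M\<rbrakk> \<Longrightarrow>
    act M (lbr G x y) m = act M x (act M y m) - act M y (act M x m)"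
  using representation unfolding representation_def by blast

end

text \<open>Arrows are pairs \<open>(x, a)\<close> with equal ends, and the bracket on them is that
  of the semidirect product of \<open>G\<close> with the abelian ideal \<open>M\<close>. The minus
  signs match the convention of \<open>cochain_of\<close>.\<close>

definition lie2_of ::
  "('k, 'g::ab_group_add, 'c) lie_alg_scheme \<Rightarrow> ('k, 'g, 'm::ab_group_add, 'd) lie_rep_scheme \<Rightarrow>
   ('g, 'm) cochain \<Rightarrow> ('k, 'g, 'g \<times> 'm) lie2"
where
  "lie2_of G M p =
    \<lparr>Ob = \<lparr>smul = smul G, vcar = vcar G\<rparr>,
     Ar = \<lparr>smul = (\<lambda>c f. (smul G c (fst f), smul M c (snd f))), vcar = vcar G \<times> vcar M\<rparr>,
     src = fst, tgt = fst, idt = (\<lambda>x. (x, 0)), cmp = (\<lambda>g f. (fst f, snd g + snd f)),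
     obr = lbr G,
     abr = (\<lambda>f g. (lbr G (fst f) (fst g), act M (fst f) (snd g) - act M (fst g) (snd f))),
     altr = (\<lambda>x y. (lbr G x y, - fst p x y)),
     jacr = (\<lambda>x y z. (lbr G x (lbr G y z), - snd p x y z))\<rparr>"

lemma lie2_of_simps [simp]:
  "smul (Ob (lie2_of G M p)) = smul G" "vcar (Ob (lie2_of G M p)) = vcar G"
  "smul (Ar (lie2_of G M p)) c f = (smul G c (fst f), smul M c (snd f))"
  "vcar (Ar (lie2_of G M p)) = vcar G \<times> vcar M"
  "src (lie2_of G M p) = fst" "tgt (lie2_of G M p) = fst"
  "idt (lie2_of G M p) x = (x, 0)" "cmp (lie2_of G M p) g f = (fst f, snd g + snd f)"
  "obr (lie2_of G M p) = lbr G"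
  "abr (lie2_of G M p) f g = (lbr G (fst f) (fst g), act M (fst f) (snd g) - act M (fst g) (snd f))"
  "altr (lie2_of G M p) x y = (lbr G x y, - fst p x y)"
  "jacr (lie2_of G M p) x y z = (lbr G x (lbr G y z), - snd p x y z)"
  by (simp_all add: lie2_of_def)

locale lie_cocycle = lie_module G M
  for G :: "('k::field, 'g::ab_group_add) lie_alg"
    and M :: "('k, 'g, 'm::ab_group_add) lie_rep" +
  fixes p :: "('g, 'm) cochain"
  assumes cocycle: "p \<in> ZL3 G M"
begin

abbreviation "L \<equiv> lie2_of G M p"

lemma fst_bilin: "bilin_map G G M (fst p)" and snd_trilin: "trilin_map G G G M (snd p)"
  using cocycle by (auto simp: ZL3_def Hom2_def Hom3_def)

lemmas cochain_closed [simp] = bilin_closed[OF fst_bilin] trilin_closed[OF snd_trilin]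

lemma cocycle1:
  "\<lbrakk>x \<in> vcar G; y \<in> vcar G; z \<in> vcar G; w \<in> vcar G\<rbrakk> \<Longrightarrow>
    act M x (snd p y z w) - act M y (snd p x z w) + act M z (snd p x y w) - act M w (snd p x y z)
        - snd p (lbr G x y) z w - snd p y (lbr G x z) w - snd p y z (lbr G x w)
        + snd p x (lbr G y z) w + snd p x z (lbr G y w) - snd p x y (lbr G z w) = 0"
  and cocycle2: "\<lbrakk>x \<in> vcar G; y \<in> vcar G; z \<in> vcar G\<rbrakk> \<Longrightarrow>
    snd p x y z + snd p y x z = act M z (fst p x y)"
  and cocycle3: "\<lbrakk>x \<in> vcar G; y \<in> vcar G; z \<in> vcar G\<rbrakk> \<Longrightarrow>
    snd p x y z + snd p x z y = act M x (fst p y z) - fst p (lbr G x y) z - fst p y (lbr G x z)"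
  and cocycle4: "\<lbrakk>x \<in> vcar G; y \<in> vcar G; z \<in> vcar G\<rbrakk> \<Longrightarrow>
    fst p (lbr G x y) z = fst p z (lbr G x y)"
  using cocycle by (auto simp: ZL3_def ract_def)

lemma linear_category: "linear_category L"
proof
  show "vspace (Ob L)" using vspaces(1) by (simp add: vspace_def)
  have "vector_space (smul (Ar L))"
    using vspaces unfolding vspace_def vector_space_def by simp
  moreover from this have "module.subspace (smul (Ar L)) (vcar (Ar L))"
    by (intro module.subspaceI) (auto simp: module_iff_vector_space zero_prod_def)
  ultimately show "vspace (Ar L)" by (simp add: vspace_def)
qed (auto simp: lin_map_def composable_def vspace_smul_simps algebra_simps)

lemma inv_arrow: "f \<in> vcar G \<times> vcar M \<Longrightarrow> inv_arrow L f = (fst f, - snd f)"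
  using linear_category.inv_arrow_eq[OF linear_category, of f] by (auto simp: prod_eq_iff)

text \<open>The object components of the axioms are antisymmetry and the Leibniz rule in
  \<open>G\<close>. The \<open>M\<close> components of (L1)-(L4) are \<open>cocycle1\<close> to
  \<open>cocycle4\<close>.\<close>

lemma lie_2_algebra: "lie_2_algebra L"
proof (intro lie_2_algebra.intro linear_category lie_2_algebra_axioms.intro)
  have "bilin_map (Ob L) (Ob L) (Ob L) (obr L)"
    using lbr_bilin by (simp add: bilin_map_def lin_map_def)
  moreover have "bilin_map (Ar L) (Ar L) (Ar L) (abr L)"
    by (auto simp: bilin_map_def lin_map_def vspace_smul_simps algebra_simps)
  ultimately show "bilinear_functor L L L (obr L) (abr L)"
    by (auto simp: bilinear_functor_def composable_def algebra_simps)
next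
  have "bilin_map (Ob L) (Ob L) (Ar L) (altr L)"
    using bilin_map_neg[OF fst_bilin vspaces(2)] lbr_bilin
    by (simp add: bilin_map_def lin_map_def)
  then show "bilinear_nat_trans L L (obr L) (abr L) (\<lambda>x y. - obr L y x) (\<lambda>f g. - abr L g f) (altr L)"
    by (auto simp: bilinear_nat_trans_def antisym)
next
  have "trilin_map G G G M (\<lambda>x y z. - snd p x y z)"
    using trilin_map_compose[OF snd_trilin lin_map_id, of M uminus] vspaces(2)
    by (simp add: lin_map_def vspace_smul_simps)
  then have "trilin_map (Ob L) (Ob L) (Ob L) (Ar L) (jacr L)"
    by (simp add: trilin_map_def bilin_map_def lin_map_def)
  then show "trilinear_nat_trans L L
      (\<lambda>x y z. obr L x (obr L y z)) (\<lambda>f g h. abr L f (abr L g h))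
      (\<lambda>x y z. obr L (obr L x y) z + obr L y (obr L x z))
      (\<lambda>f g h. abr L (abr L f g) h + abr L g (abr L f h)) (jacr L)"
    \<comment> \<open>The Leibniz rule identifies source and target, and \<open>act_lbr\<close>
      gives the \<open>M\<close> component of the naturality square.\<close>
    by (auto simp: trilinear_nat_trans_def Leibniz) (simp add: act_lbr)
next
  fix x y z w assume "x \<in> vcar (Ob L)" "y \<in> vcar (Ob L)" "z \<in> vcar (Ob L)" "w \<in> vcar (Ob L)"
  then have O: "x \<in> vcar G" "y \<in> vcar G" "z \<in> vcar G" "w \<in> vcar G" by simp_all
  show "(abr L (jacr L x y z) (idt L w) + idt L (obr L (obr L y z) (obr L x w))
          + idt L (obr L (obr L x z) (obr L y w)) + abr L (idt L z) (jacr L x y w))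
        \<cdot>\<^bsub>L\<^esub> (jacr L x (obr L y z) w + jacr L x z (obr L y w))
        \<cdot>\<^bsub>L\<^esub> abr L (idt L x) (jacr L y z w)
      = (idt L (obr L (obr L (obr L x y) z) w) + idt L (obr L z (obr L (obr L x y) w))
          + jacr L y (obr L x z) w + jacr L y z (obr L x w))
        \<cdot>\<^bsub>L\<^esub> (jacr L (obr L x y) z w + abr L (idt L y) (jacr L x z w))
        \<cdot>\<^bsub>L\<^esub> jacr L x y (obr L z w)"
    using O cocycle1[OF O] by (simp add: algebra_simps)
next
  fix x y z assume "x \<in> vcar (Ob L)" "y \<in> vcar (Ob L)" "z \<in> vcar (Ob L)"
  then have O: "x \<in> vcar G" "y \<in> vcar G" "z \<in> vcar G" by simp_all
  show "(- Jhat L y x z) \<cdot>\<^bsub>L\<^esub> abr L (altr L x y) (idt L z) = Jhat L x y z"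
    using O cocycle2[OF O] Leibniz[OF O] by (simp add: Jhat_def inv_arrow algebra_simps)
  show "(- jacr L x z y) \<cdot>\<^bsub>L\<^esub> abr L (idt L x) (altr L y z) =
      (altr L (obr L x y) z + altr L y (obr L x z)) \<cdot>\<^bsub>L\<^esub> jacr L x y z"
    using O cocycle3[OF O] by (simp add: algebra_simps)
  show "(- altr L (obr L y z) x) \<cdot>\<^bsub>L\<^esub> altr L x (obr L y z) = idt L (obr L x (obr L y z))"
    using O cocycle4[of y z x] by simp
qed

lemma skeletal: "skeletal L"
  by (simp add: linear_category.skeletal_iff[OF linear_category])

text \<open>The representation recovered from \<open>L\<close> lives on \<open>0 \<times> M\<close>,
  so it is isomorphic rather than equal to \<open>M\<close>, by the second projection. The cocycles
  then correspond exactly, and \<open>0\<close> serves as the primitive.\<close>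

lemma data_isomorphic: "data_isomorphic (data_of L) (G, M, HL3_class G M p)"
proof -
  interpret L: skeletal_lie_2_algebra L
    using lie_2_algebra skeletal by (simp add: skeletal_lie_2_algebra_def skeletal_lie_2_algebra_axioms_def)
  have "bij_betw snd (ker_src L) (vcar M)"
    by (rule bij_betw_byWitness[where f' = "\<lambda>a. (0, a)"]) (auto simp: ker_src_def)
  then have "cocycle_iso (lie_alg_of L) (rep_of L) (cochain_of L) G M p (\<lambda>x. x) snd (\<lambda>x y. 0)"
    by (simp add: cocycle_iso_def lie_iso_def rep_iso_def lin_map_def bilin_map_def ker_src_def
        cochain_of_def vspace_smul_simps bij_betw_def)
  then show ?thesis
    unfolding data_of_def
    using data_isomorphic_iff[OF L.data.lie_module_axioms lie_module_axioms L.cochain_of_cocycle cocycle]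
    by blast
qed

end

section \<open>Classification of skeletal Lie 2-algebras by classes in \<open>HL3\<close>\<close>

theorem theorem4p5:
  shows "(\<forall>L :: ('k::field, 'o::ab_group_add, 'a::ab_group_add) lie2.
            lie_2_algebra L \<and> skeletal L \<longrightarrow>
              (\<forall>a\<in>ker_src L. tgt L a = 0) \<and>
              (\<forall>x\<in>vcar (Ob L). \<forall>a\<in>ker_src L.
                 abr L (idt L x) a = - abr L a (idt L x)) \<and>
              cochain_of L \<in> ZL3 (lie_alg_of L) (rep_of L) \<and>
              classifying_data (data_of L)) \<and>
         (\<forall>T :: ('k, 'g::ab_group_add, 'm::ab_group_add) classifying_data.
            classifying_data T \<longrightarrow>
              (\<exists>L :: ('k, 'g, 'g \<times> 'm) lie2.
                 lie_2_algebra L \<and> skeletal L \<and> data_isomorphic (data_of L) T)) \<and>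
         (\<forall>(L :: ('k, 'o, 'a) lie2) (L' :: ('k, 'p::ab_group_add, 'b::ab_group_add) lie2).
            lie_2_algebra L \<and> skeletal L \<and> lie_2_algebra L' \<and> skeletal L' \<longrightarrow>
              (lie2_equivalent L L' \<longleftrightarrow> data_isomorphic (data_of L) (data_of L')))"
proof (intro conjI allI impI)
  fix L :: "('k, 'o, 'a) lie2" assume L: "lie_2_algebra L \<and> skeletal L"
  then interpret skeletal_lie_2_algebra L
    by (simp add: skeletal_lie_2_algebra_def skeletal_lie_2_algebra_axioms_def)
  show "\<forall>a\<in>ker_src L. tgt L a = 0" by simp
  show "\<forall>x\<in>vcar (Ob L). \<forall>a\<in>ker_src L. abr L (idt L x) a = - abr L a (idt L x)"
    by (simp add: abr_ker_idt)
  show "cochain_of L \<in> ZL3 (lie_alg_of L) (rep_of L)" by (rule cochain_of_cocycle)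
  show "classifying_data (data_of L)" by (rule classifying_data_data_of)
next
  fix T :: "('k, 'g, 'm) classifying_data" assume T: "classifying_data T"
  obtain G M c where GMc: "T = (G, M, c)" by (cases T)
  \<comment> \<open>Any representative \<open>p\<close> of the class serves, as the data retain only
    its class.\<close>
  with T obtain p where "lie_algebra G" "representation G M" "p \<in> ZL3 G M" "c = HL3_class G M p"
    by (auto simp: classifying_data_def HL3_def HL3_class_def elim: quotientE)
  then interpret lie_cocycle G M p by unfold_locales
  show "\<exists>L :: ('k, 'g, 'g \<times> 'm) lie2. lie_2_algebra L \<and> skeletal L \<and> data_isomorphic (data_of L) T"
    using lie_2_algebra skeletal data_isomorphic GMc \<open>c = _\<close> by blast
next
  fix L :: "('k, 'o, 'a) lie2" and L' :: "('k, 'p, 'b) lie2"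
  assume "lie_2_algebra L \<and> skeletal L \<and> lie_2_algebra L' \<and> skeletal L'"
  then interpret skeletal_pair L L'
    by (simp add: skeletal_pair_def skeletal_lie_2_algebra_def skeletal_lie_2_algebra_axioms_def)
  show "lie2_equivalent L L' \<longleftrightarrow> data_isomorphic (data_of L) (data_of L')" by (rule equivalent_iff)
qed

end
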